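(* Let $X$ be a simplicial object in an abelian category $\mathcal{A}$ and let $m\geq1$. The following are equivalent: (1) The simplicial object $X$ is $2m$-Segal. (2) The simplicial object $X$ is an outer $m$-Kan complex. (3) The connective chain complex $\overline{X}=C(X)$ is $m$-truncated.
   Context: $[n]=\{0<\dots<n\}$. For a collection $\mathcal{F}$ of subsets of $[n]$ let $X_{\mathcal F}=\lim\big((\Delta_{/\mathcal F})^{\mathrm{op}}\to\Delta^{\mathrm{op}}\xrightarrow{X}\mathcal{A}\big)$, where $\Delta_{/\mathcal F}$ is the category of simplices $[k]\to[n]$ of $\Delta^n$ whose image is contained in some $f\in\mathcal{F}$. $X$ satisfies descent with respect to $\mathcal{F}$ if the canonical map $X_n\to X_{\mathcal F}$ is an isomorphism. Outer $m$-Kan complex: for every $n>m$ the maps $X_n\to X_{\Lambda^n_0}$ and $X_n\to X_{\Lambda^n_n}$ are isomorphisms, where $\Lambda_i^n=\{[n]\setminus\{j\}\mid j\ne i\}$. $2m$-Segal: For $I\subset[n]$, an element $i\in[n]\setminus I$ is an even (odd) gap of $I$ if $|\{j\in I\mid j>i\}|$ is even (odd); $I$ is even (odd) if all its gaps are even (odd). For $n\ge k$ the lower (upper) $k$-Segal cover of $[n]$ consists of all even (odd) subsets of $[n]$ of cardinality $k+1$. $X$ is $k$-Segal if it satisfies descent with respect to the lower and the upper $k$-Segal covers of $[n]$ for all $n\geq k$. $C(X)=\overline{X}$ is the normalised Moore chain complex: $\overline{X}_n=\bigcap_{i=1}^n\ker(d_i\colon X_n\to X_{n-1})$ with differential $d_0$.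 A connective chain complex $Y$ in $\mathcal{A}$ is $m$-truncated if $Y_n$ is a zero object for all $n>m$. *)

theory Defs
  imports "HOL-Algebra.Group"
begin

section \<open>Categories, functors and limits\<close>

record ('o, 'm) cat =
  Obj :: "'o set"
  Arr :: "'m set"
  Dom :: "'m \<Rightarrow> 'o"
  Cod :: "'m \<Rightarrow> 'o"
  Ident :: "'o \<Rightarrow> 'm"
  Comp :: "'m \<Rightarrow> 'm \<Rightarrow> 'm"  (infixl "\<cdot>\<index>" 70)

definition homs :: "('o, 'm, 'x) cat_scheme \<Rightarrow> 'o \<Rightarrow> 'o \<Rightarrow> 'm set" where
  "homs C a b = {f \<in> Arr C. Dom C f = a \<and> Cod C f = b}"

locale category =
  fixes C :: "('o, 'm, 'x) cat_scheme" (structure)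
  assumes Dom_Obj: "f \<in> Arr C \<Longrightarrow> Dom C f \<in> Obj C"
    and Cod_Obj: "f \<in> Arr C \<Longrightarrow> Cod C f \<in> Obj C"
    and Ident_homs: "a \<in> Obj C \<Longrightarrow> Ident C a \<in> homs C a a"
    and Comp_homs: "\<lbrakk>g \<in> homs C b c; f \<in> homs C a b\<rbrakk> \<Longrightarrow> g \<cdot> f \<in> homs C a c"
    and Ident_left: "f \<in> homs C a b \<Longrightarrow> Ident C b \<cdot> f = f"
    and Ident_right: "f \<in> homs C a b \<Longrightarrow> f \<cdot> Ident C a = f"
    and Comp_assoc:
      "\<lbrakk>h \<in> homs C c d; g \<in> homs C b c; f \<in> homs C a b\<rbrakk> \<Longrightarrow> (h \<cdot> g) \<cdot> f = h \<cdot> (g \<cdot> f)"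

definition op_cat :: "('o, 'm) cat \<Rightarrow> ('o, 'm) cat" where
  "op_cat C = \<lparr>Obj = Obj C, Arr = Arr C, Dom = Cod C, Cod = Dom C,
     Ident = Ident C, Comp = (\<lambda>g f. f \<cdot>\<^bsub>C\<^esub> g)\<rparr>"

definition iso_arr :: "('o, 'm, 'x) cat_scheme \<Rightarrow> 'm \<Rightarrow> bool" where
  "iso_arr C f \<longleftrightarrow> f \<in> Arr C \<and>
     (\<exists>g \<in> homs C (Cod C f) (Dom C f).
        g \<cdot>\<^bsub>C\<^esub> f = Ident C (Dom C f) \<and> f \<cdot>\<^bsub>C\<^esub> g = Ident C (Cod C f))"

definition mono_arr :: "('o, 'm, 'x) cat_scheme \<Rightarrow> 'm \<Rightarrow> bool" where
  "mono_arr C f \<longleftrightarrow> f \<in> Arr C \<and>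
     (\<forall>a \<in> Obj C. \<forall>g \<in> homs C a (Dom C f). \<forall>h \<in> homs C a (Dom C f).
        f \<cdot>\<^bsub>C\<^esub> g = f \<cdot>\<^bsub>C\<^esub> h \<longrightarrow> g = h)"

definition epi_arr :: "('o, 'm, 'x) cat_scheme \<Rightarrow> 'm \<Rightarrow> bool" where
  "epi_arr C f \<longleftrightarrow> f \<in> Arr C \<and>
     (\<forall>b \<in> Obj C. \<forall>g \<in> homs C (Cod C f) b. \<forall>h \<in> homs C (Cod C f) b.
        g \<cdot>\<^bsub>C\<^esub> f = h \<cdot>\<^bsub>C\<^esub> f \<longrightarrow> g = h)"

definition zero_object :: "('o, 'm, 'x) cat_scheme \<Rightarrow> 'o \<Rightarrow> bool" where
  "zero_object C z \<longleftrightarrow> z \<in> Obj C \<and>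
     (\<forall>a \<in> Obj C. (\<exists>!f. f \<in> homs C a z) \<and> (\<exists>!f. f \<in> homs C z a))"

record ('o, 'm, 'p, 'n) funct =
  fobj :: "'o \<Rightarrow> 'p"
  fmap :: "'m \<Rightarrow> 'n"

definition is_functor ::
  "('o, 'm, 'x) cat_scheme \<Rightarrow> ('p, 'n, 'y) cat_scheme \<Rightarrow> ('o, 'm, 'p, 'n) funct \<Rightarrow> bool" where
  "is_functor C D F \<longleftrightarrow>
     (\<forall>a \<in> Obj C. fobj F a \<in> Obj D) \<and>
     (\<forall>f \<in> Arr C. fmap F f \<in> homs D (fobj F (Dom C f)) (fobj F (Cod C f))) \<and>
     (\<forall>a \<in> Obj C. fmap F (Ident C a) = Ident D (fobj F a)) \<and>
     (\<forall>f \<in> Arr C. \<forall>g \<in> Arr C. Cod C f = Dom C g \<longrightarrow>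
        fmap F (g \<cdot>\<^bsub>C\<^esub> f) = fmap F g \<cdot>\<^bsub>D\<^esub> fmap F f)"

definition comp_functor ::
  "('p, 'n, 'q, 'k) funct \<Rightarrow> ('o, 'm, 'p, 'n) funct \<Rightarrow> ('o, 'm, 'q, 'k) funct" where
  "comp_functor G F = \<lparr>fobj = fobj G \<circ> fobj F, fmap = fmap G \<circ> fmap F\<rparr>"

definition is_cone ::
  "('p, 'n, 'y) cat_scheme \<Rightarrow> ('o, 'm, 'x) cat_scheme \<Rightarrow> ('o, 'm, 'p, 'n) funct
     \<Rightarrow> 'p \<Rightarrow> ('o \<Rightarrow> 'n) \<Rightarrow> bool" where
  "is_cone A J D c p \<longleftrightarrow> c \<in> Obj A \<and>
     (\<forall>j \<in> Obj J. p j \<in> homs A c (fobj D j)) \<and>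
     (\<forall>f \<in> Arr J. fmap D f \<cdot>\<^bsub>A\<^esub> p (Dom J f) = p (Cod J f))"

definition is_limit ::
  "('p, 'n, 'y) cat_scheme \<Rightarrow> ('o, 'm, 'x) cat_scheme \<Rightarrow> ('o, 'm, 'p, 'n) funct
     \<Rightarrow> 'p \<Rightarrow> ('o \<Rightarrow> 'n) \<Rightarrow> bool" where
  "is_limit A J D l p \<longleftrightarrow> is_cone A J D l p \<and>
     (\<forall>c q. is_cone A J D c q \<longrightarrow>
        (\<exists>!u. u \<in> homs A c l \<and> (\<forall>j \<in> Obj J. p j \<cdot>\<^bsub>A\<^esub> u = q j)))"

section \<open>Abelian categories\<close>

text \<open>The addition is only meaningful on pairs of parallel arrows.\<close>

record ('o, 'm) ab_cat = "('o, 'm) cat" +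
  hom_add :: "'m \<Rightarrow> 'm \<Rightarrow> 'm"
  hom_zero :: "'o \<Rightarrow> 'o \<Rightarrow> 'm"

definition hom_group :: "('o, 'm, 'x) ab_cat_scheme \<Rightarrow> 'o \<Rightarrow> 'o \<Rightarrow> 'm monoid" where
  "hom_group A a b =
     \<lparr>carrier = homs A a b, mult = hom_add A, one = hom_zero A a b\<rparr>"

locale preadditive_category = category A
  for A :: "('o, 'm, 'x) ab_cat_scheme" (structure) +
  assumes hom_comm_group: "\<lbrakk>a \<in> Obj A; b \<in> Obj A\<rbrakk> \<Longrightarrow> comm_group (hom_group A a b)"
    and Comp_add_left: "\<lbrakk>g \<in> homs A b c; h \<in> homs A b c; f \<in> homs A a b\<rbrakk>
          \<Longrightarrow> hom_add A g h \<cdot> f = hom_add A (g \<cdot> f) (h \<cdot> f)"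
    and Comp_add_right: "\<lbrakk>g \<in> homs A b c; f \<in> homs A a b; h \<in> homs A a b\<rbrakk>
          \<Longrightarrow> g \<cdot> hom_add A f h = hom_add A (g \<cdot> f) (g \<cdot> h)"

definition is_kernel :: "('o, 'm, 'x) ab_cat_scheme \<Rightarrow> 'm \<Rightarrow> 'm \<Rightarrow> bool" where
  "is_kernel A f k \<longleftrightarrow> k \<in> Arr A \<and> Cod A k = Dom A f \<and>
     f \<cdot>\<^bsub>A\<^esub> k = hom_zero A (Dom A k) (Cod A f) \<and>
     (\<forall>a \<in> Obj A. \<forall>h \<in> homs A a (Dom A f).
        f \<cdot>\<^bsub>A\<^esub> h = hom_zero A a (Cod A f) \<longrightarrow>
        (\<exists>!u. u \<in> homs A a (Dom A k) \<and> k \<cdot>\<^bsub>A\<^esub> u = h))"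

definition is_cokernel :: "('o, 'm, 'x) ab_cat_scheme \<Rightarrow> 'm \<Rightarrow> 'm \<Rightarrow> bool" where
  "is_cokernel A f q \<longleftrightarrow> q \<in> Arr A \<and> Dom A q = Cod A f \<and>
     q \<cdot>\<^bsub>A\<^esub> f = hom_zero A (Dom A f) (Cod A q) \<and>
     (\<forall>b \<in> Obj A. \<forall>h \<in> homs A (Cod A f) b.
        h \<cdot>\<^bsub>A\<^esub> f = hom_zero A (Dom A f) b \<longrightarrow>
        (\<exists>!u. u \<in> homs A (Cod A q) b \<and> u \<cdot>\<^bsub>A\<^esub> q = h))"

definition is_biproduct ::
  "('o, 'm, 'x) ab_cat_scheme \<Rightarrow> 'o \<Rightarrow> 'o \<Rightarrow> 'o \<Rightarrow> 'm \<Rightarrow> 'm \<Rightarrow> 'm \<Rightarrow> 'm \<Rightarrow> bool" where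
  "is_biproduct A a b c i1 i2 p1 p2 \<longleftrightarrow> c \<in> Obj A \<and>
     i1 \<in> homs A a c \<and> i2 \<in> homs A b c \<and> p1 \<in> homs A c a \<and> p2 \<in> homs A c b \<and>
     p1 \<cdot>\<^bsub>A\<^esub> i1 = Ident A a \<and> p2 \<cdot>\<^bsub>A\<^esub> i2 = Ident A b \<and>
     hom_add A (i1 \<cdot>\<^bsub>A\<^esub> p1) (i2 \<cdot>\<^bsub>A\<^esub> p2) = Ident A c"

locale abelian_category = preadditive_category +
  assumes ex_zero_object: "\<exists>z. zero_object A z"
    and ex_biproduct:
      "\<lbrakk>a \<in> Obj A; b \<in> Obj A\<rbrakk> \<Longrightarrow> \<exists>c i1 i2 p1 p2. is_biproduct A a b c i1 i2 p1 p2"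
    and ex_kernel: "f \<in> Arr A \<Longrightarrow> \<exists>k. is_kernel A f k"
    and ex_cokernel: "f \<in> Arr A \<Longrightarrow> \<exists>q. is_cokernel A f q"
    and mono_normal: "mono_arr A f \<Longrightarrow> \<exists>g \<in> Arr A. is_kernel A g f"
    and epi_normal: "epi_arr A f \<Longrightarrow> \<exists>g \<in> Arr A. is_cokernel A g f"

text \<open>A subobject of \<open>x\<close> is represented by a monomorphism with codomain \<open>x\<close>; the intersection
  of a family of subobjects is their wide pullback over \<open>x\<close>. The intersection of the empty
  family is \<open>x\<close> itself.\<close>

definition factors_through :: "('o, 'm, 'x) cat_scheme \<Rightarrow> 'm \<Rightarrow> 'm \<Rightarrow> bool" where
  "factors_through C h s \<longleftrightarrow> (\<exists>u \<in> homs C (Dom C h) (Dom C s). s \<cdot>\<^bsub>C\<^esub> u = h)"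

definition is_intersection :: "('o, 'm, 'x) cat_scheme \<Rightarrow> 'o \<Rightarrow> 'm set \<Rightarrow> 'm \<Rightarrow> bool" where
  "is_intersection C x S k \<longleftrightarrow> mono_arr C k \<and> Cod C k = x \<and>
     (\<forall>s \<in> S. factors_through C k s) \<and>
     (\<forall>a \<in> Obj C. \<forall>h \<in> homs C a x.
        (\<forall>s \<in> S. factors_through C h s) \<longrightarrow> factors_through C h k)"

text \<open>Kernels and intersections are unique only up to isomorphism; we fix a choice.\<close>

definition kernel_arr :: "('o, 'm, 'x) ab_cat_scheme \<Rightarrow> 'm \<Rightarrow> 'm" where
  "kernel_arr A f = (SOME k. is_kernel A f k)"

definition intersection_arr :: "('o, 'm, 'x) cat_scheme \<Rightarrow> 'o \<Rightarrow> 'm set \<Rightarrow> 'm" where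
  "intersection_arr C x S = (SOME k. is_intersection C x S k)"

section \<open>The simplex category and simplicial objects\<close>

text \<open>The object \<open>[n] = {0<\<dots><n}\<close> is represented by the number \<open>n\<close>, and a monotone map
  \<open>[k] \<rightarrow> [n]\<close> by a triple \<open>(k, n, \<phi>)\<close> with \<open>\<phi>\<close> extensional on \<open>{0..k}\<close>.\<close>

type_synonym delta_arr = "nat \<times> nat \<times> (nat \<Rightarrow> nat)"

definition Delta :: "(nat, delta_arr) cat" where
  "Delta = \<lparr>
     Obj = UNIV,
     Arr = {(k, n, \<phi>). \<phi> \<in> {0..k} \<rightarrow>\<^sub>E {0..n} \<and> mono_on {0..k} \<phi>},
     Dom = (\<lambda>(k, n, \<phi>). k),
     Cod = (\<lambda>(k, n, \<phi>). n),
     Ident = (\<lambda>n. (n, n, \<lambda>x \<in> {0..n}. x)),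
     Comp = (\<lambda>(l, n, \<psi>) (k, l', \<phi>). (k, n, compose {0..k} \<psi> \<phi>))\<rparr>"

fun delta_image :: "delta_arr \<Rightarrow> nat set" where
  "delta_image (k, n, \<phi>) = \<phi> ` {0..k}"

type_synonym ('o, 'm) sobj = "(nat, delta_arr, 'o, 'm) funct"

definition simplicial_object :: "('o, 'm, 'x) ab_cat_scheme \<Rightarrow> ('o, 'm) sobj \<Rightarrow> bool" where
  "simplicial_object A X \<longleftrightarrow> is_functor (op_cat Delta) A X"

definition coface :: "nat \<Rightarrow> nat \<Rightarrow> delta_arr" where
  "coface n i = (n - 1, n, \<lambda>j \<in> {0..n - 1}. if j < i then j else j + 1)"

definition face :: "('o, 'm) sobj \<Rightarrow> nat \<Rightarrow> nat \<Rightarrow> 'm" where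
  "face X n i = fmap X (coface n i)"

section \<open>Descent\<close>

text \<open>The category \<open>\<Delta>\<^bsub>/\<F>\<^esub>\<close>: its objects are the simplices \<open>\<sigma> : [k] \<rightarrow> [n]\<close> with image contained
  in a member of \<open>\<F>\<close>; an arrow \<open>\<sigma> \<rightarrow> \<tau>\<close> is a map \<open>\<alpha>\<close> in \<open>\<Delta>\<close> with \<open>\<tau> \<circ> \<alpha> = \<sigma>\<close>.\<close>

definition simplices_over :: "nat \<Rightarrow> nat set set \<Rightarrow> (delta_arr, delta_arr \<times> delta_arr \<times> delta_arr) cat" where
  "simplices_over n \<F> = (let S = {\<sigma> \<in> Arr Delta. Cod Delta \<sigma> = n \<and> (\<exists>f \<in> \<F>. delta_image \<sigma> \<subseteq> f)} in
     \<lparr>Obj = S,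
      Arr = {(\<sigma>, \<alpha>, \<tau>). \<sigma> \<in> S \<and> \<tau> \<in> S \<and> \<alpha> \<in> homs Delta (Dom Delta \<sigma>) (Dom Delta \<tau>)
               \<and> \<tau> \<cdot>\<^bsub>Delta\<^esub> \<alpha> = \<sigma>},
      Dom = (\<lambda>(\<sigma>, \<alpha>, \<tau>). \<sigma>),
      Cod = (\<lambda>(\<sigma>, \<alpha>, \<tau>). \<tau>),
      Ident = (\<lambda>\<sigma>. (\<sigma>, Ident Delta (Dom Delta \<sigma>), \<sigma>)),
      Comp = (\<lambda>(\<sigma>', \<beta>, \<tau>) (\<sigma>, \<alpha>, \<tau>'). (\<sigma>, \<beta> \<cdot>\<^bsub>Delta\<^esub> \<alpha>, \<tau>))\<rparr>)"

definition simplices_forget ::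
  "(delta_arr, delta_arr \<times> delta_arr \<times> delta_arr, nat, delta_arr) funct" where
  "simplices_forget = \<lparr>fobj = Dom Delta, fmap = (\<lambda>(\<sigma>, \<alpha>, \<tau>). \<alpha>)\<rparr>"

text \<open>\<open>is_X_over A X n \<F> L p\<close>: the object \<open>L\<close> with projections \<open>p \<sigma> : L \<rightarrow> X\<^sub>k\<close>, for
  \<open>\<sigma> : [k] \<rightarrow> [n]\<close>, is a limit \<open>X\<^bsub>\<F>\<^esub>\<close>. The canonical map from \<open>X\<^sub>n\<close> is the one
  whose component at \<open>\<sigma>\<close> is \<open>X(\<sigma>)\<close>.\<close>

definition is_X_over ::
  "('o, 'm, 'x) ab_cat_scheme \<Rightarrow> ('o, 'm) sobj \<Rightarrow> nat \<Rightarrow> nat set set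
     \<Rightarrow> 'o \<Rightarrow> (delta_arr \<Rightarrow> 'm) \<Rightarrow> bool" where
  "is_X_over A X n \<F> L p \<longleftrightarrow>
     is_limit A (op_cat (simplices_over n \<F>)) (comp_functor X simplices_forget) L p"

definition descent ::
  "('o, 'm, 'x) ab_cat_scheme \<Rightarrow> ('o, 'm) sobj \<Rightarrow> nat \<Rightarrow> nat set set \<Rightarrow> bool" where
  "descent A X n \<F> \<longleftrightarrow>
     (\<exists>L p u. is_X_over A X n \<F> L p \<and> u \<in> homs A (fobj X n) L \<and>
        (\<forall>\<sigma> \<in> Obj (simplices_over n \<F>). p \<sigma> \<cdot>\<^bsub>A\<^esub> u = fmap X \<sigma>) \<and> iso_arr A u)"

section \<open>Outer Kan complexes and higher Segal objects\<close>

definition horn :: "nat \<Rightarrow> nat \<Rightarrow> nat set set" where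
  "horn n i = {{0..n} - {j} | j. j \<in> {0..n} \<and> j \<noteq> i}"

definition outer_kan :: "('o, 'm, 'x) ab_cat_scheme \<Rightarrow> nat \<Rightarrow> ('o, 'm) sobj \<Rightarrow> bool" where
  "outer_kan A m X \<longleftrightarrow> (\<forall>n > m. descent A X n (horn n 0) \<and> descent A X n (horn n n))"

definition even_gap :: "nat \<Rightarrow> nat set \<Rightarrow> nat \<Rightarrow> bool" where
  "even_gap n I i \<longleftrightarrow> i \<in> {0..n} - I \<and> even (card {j \<in> I. j > i})"

definition odd_gap :: "nat \<Rightarrow> nat set \<Rightarrow> nat \<Rightarrow> bool" where
  "odd_gap n I i \<longleftrightarrow> i \<in> {0..n} - I \<and> odd (card {j \<in> I. j > i})"

definition even_subset :: "nat \<Rightarrow> nat set \<Rightarrow> bool" where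
  "even_subset n I \<longleftrightarrow> I \<subseteq> {0..n} \<and> (\<forall>i \<in> {0..n} - I. even_gap n I i)"

definition odd_subset :: "nat \<Rightarrow> nat set \<Rightarrow> bool" where
  "odd_subset n I \<longleftrightarrow> I \<subseteq> {0..n} \<and> (\<forall>i \<in> {0..n} - I. odd_gap n I i)"

definition lower_segal_cover :: "nat \<Rightarrow> nat \<Rightarrow> nat set set" where
  "lower_segal_cover k n = {I. even_subset n I \<and> card I = k + 1}"

definition upper_segal_cover :: "nat \<Rightarrow> nat \<Rightarrow> nat set set" where
  "upper_segal_cover k n = {I. odd_subset n I \<and> card I = k + 1}"

definition segal :: "('o, 'm, 'x) ab_cat_scheme \<Rightarrow> nat \<Rightarrow> ('o, 'm) sobj \<Rightarrow> bool" where
  "segal A k X \<longleftrightarrow> (\<forall>n \<ge> k. descent A X n (lower_segal_cover k n) \<and>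
                              descent A X n (upper_segal_cover k n))"

section \<open>The normalised Moore chain complex\<close>

text \<open>In a connective chain complex \<open>Y\<close>, the differential \<open>chain_diff Y n\<close> goes from \<open>Y\<^sub>n\<close>
  to \<open>Y\<^bsub>n-1\<^esub>\<close> and is only meaningful for \<open>n \<ge> 1\<close>.\<close>

record ('o, 'm) chain =
  chain_obj :: "nat \<Rightarrow> 'o"
  chain_diff :: "nat \<Rightarrow> 'm"

definition chain_complex :: "('o, 'm, 'x) ab_cat_scheme \<Rightarrow> ('o, 'm) chain \<Rightarrow> bool" where
  "chain_complex A Y \<longleftrightarrow> (\<forall>n. chain_obj Y n \<in> Obj A) \<and>
     (\<forall>n \<ge> 1. chain_diff Y n \<in> homs A (chain_obj Y n) (chain_obj Y (n - 1))) \<and>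
     (\<forall>n \<ge> 2. chain_diff Y (n - 1) \<cdot>\<^bsub>A\<^esub> chain_diff Y n
                 = hom_zero A (chain_obj Y n) (chain_obj Y (n - 2)))"

definition truncated :: "('o, 'm, 'x) ab_cat_scheme \<Rightarrow> nat \<Rightarrow> ('o, 'm) chain \<Rightarrow> bool" where
  "truncated A m Y \<longleftrightarrow> (\<forall>n > m. zero_object A (chain_obj Y n))"

definition moore_incl :: "('o, 'm, 'x) ab_cat_scheme \<Rightarrow> ('o, 'm) sobj \<Rightarrow> nat \<Rightarrow> 'm" where
  "moore_incl A X n = intersection_arr A (fobj X n) ((\<lambda>i. kernel_arr A (face X n i)) ` {1..n})"

definition moore_complex ::
  "('o, 'm, 'x) ab_cat_scheme \<Rightarrow> ('o, 'm) sobj \<Rightarrow> ('o, 'm) chain" where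
  "moore_complex A X =
     \<lparr>chain_obj = (\<lambda>n. Dom A (moore_incl A X n)),
      chain_diff = (\<lambda>n. THE d. d \<in> homs A (Dom A (moore_incl A X n)) (Dom A (moore_incl A X (n - 1)))
                        \<and> moore_incl A X (n - 1) \<cdot>\<^bsub>A\<^esub> d = face X n 0 \<cdot>\<^bsub>A\<^esub> moore_incl A X n)\<rparr>"

section \<open>Well-definedness\<close>

lemma category_op_cat:
  assumes "category C"
  shows "category (op_cat C)"
proof -
  interpret category C by fact
  have h: "homs (op_cat C) a b = homs C b a" for a b
    by (auto simp: homs_def op_cat_def)
  show ?thesis
  proof (unfold_locales, unfold h)
    fix k g f a b c d
    assume "k \<in> homs C d c" "g \<in> homs C c b" "f \<in> homs C b a"
    then show "(k \<cdot>\<^bsub>op_cat C\<^esub> g) \<cdot>\<^bsub>op_cat C\<^esub> f = k \<cdot>\<^bsub>op_cat C\<^esub> (g \<cdot>\<^bsub>op_cat C\<^esub> f)"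
      by (simp add: op_cat_def Comp_assoc)
  qed (simp_all add: op_cat_def Dom_Obj Cod_Obj Ident_homs Comp_homs Ident_left Ident_right)
qed

lemma Delta_homs:
  "f \<in> homs Delta k n \<longleftrightarrow>
     (\<exists>\<phi>. f = (k, n, \<phi>) \<and> \<phi> \<in> {0..k} \<rightarrow>\<^sub>E {0..n} \<and> mono_on {0..k} \<phi>)"
  by (auto simp: homs_def Delta_def)

lemma category_Delta: "category Delta"
proof
  fix f assume "f \<in> Arr Delta"
  then show "Dom Delta f \<in> Obj Delta" "Cod Delta f \<in> Obj Delta"
    by (auto simp: Delta_def)
next
  fix a :: nat
  show "Ident Delta a \<in> homs Delta a a"
    unfolding Delta_homs by (auto simp: Delta_def mono_on_def)
next
  fix g f a b c
  assume "g \<in> homs Delta b c" "f \<in> homs Delta a b"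
  then obtain \<psi> \<phi> where gf: "g = (b, c, \<psi>)" "f = (a, b, \<phi>)"
    and \<psi>: "\<psi> \<in> {0..b} \<rightarrow>\<^sub>E {0..c}" "mono_on {0..b} \<psi>"
    and \<phi>: "\<phi> \<in> {0..a} \<rightarrow>\<^sub>E {0..b}" "mono_on {0..a} \<phi>"
    unfolding Delta_homs by blast
  have "mono_on {0..a} (compose {0..a} \<psi> \<phi>)"
  proof (rule mono_onI)
    fix r s assume rs: "r \<in> {0..a}" "s \<in> {0..a}" "r \<le> s"
    then have "\<phi> r \<le> \<phi> s" "\<phi> r \<in> {0..b}" "\<phi> s \<in> {0..b}"
      using mono_onD[OF \<phi>(2) rs] PiE_mem[OF \<phi>(1)] by blast+
    then show "compose {0..a} \<psi> \<phi> r \<le> compose {0..a} \<psi> \<phi> s"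
      using rs mono_onD[OF \<psi>(2)] by (simp add: compose_def)
  qed
  moreover have "compose {0..a} \<psi> \<phi> \<in> {0..a} \<rightarrow>\<^sub>E {0..c}"
  proof (rule PiE_I)
    show "compose {0..a} \<psi> \<phi> x \<in> {0..c}" if "x \<in> {0..a}" for x
      using that PiE_mem[OF \<psi>(1) PiE_mem[OF \<phi>(1) that]] by (simp add: compose_def)
  qed (simp add: compose_def)
  ultimately show "g \<cdot>\<^bsub>Delta\<^esub> f \<in> homs Delta a c"
    unfolding Delta_homs gf by (simp add: Delta_def)
next
  fix f a b
  assume "f \<in> homs Delta a b"
  then obtain \<phi> where f: "f = (a, b, \<phi>)" and \<phi>: "\<phi> \<in> {0..a} \<rightarrow>\<^sub>E {0..b}"
    unfolding Delta_homs by blast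
  have "compose {0..a} (\<lambda>x\<in>{0..b}. x) \<phi> = \<phi>" "compose {0..a} \<phi> (\<lambda>x\<in>{0..a}. x) = \<phi>"
    using \<phi> by (auto simp: compose_def PiE_iff extensional_def fun_eq_iff)
  then show "Ident Delta b \<cdot>\<^bsub>Delta\<^esub> f = f" "f \<cdot>\<^bsub>Delta\<^esub> Ident Delta a = f"
    by (simp_all add: f Delta_def)
next
  fix h g f a b c d
  assume "h \<in> homs Delta c d" "g \<in> homs Delta b c" "f \<in> homs Delta a b"
  then show "(h \<cdot>\<^bsub>Delta\<^esub> g) \<cdot>\<^bsub>Delta\<^esub> f = h \<cdot>\<^bsub>Delta\<^esub> (g \<cdot>\<^bsub>Delta\<^esub> f)"
    unfolding Delta_homs by (auto simp: Delta_def compose_def PiE_iff fun_eq_iff)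
qed

lemma category_simplices_over: "category (simplices_over n \<F>)"
proof -
  interpret D: category Delta by (rule category_Delta)
  define S where "S = {\<sigma> \<in> Arr Delta. Cod Delta \<sigma> = n \<and> (\<exists>f \<in> \<F>. delta_image \<sigma> \<subseteq> f)}"
  have S: "\<sigma> \<in> homs Delta (Dom Delta \<sigma>) n" if "\<sigma> \<in> S" for \<sigma>
    using that by (simp add: S_def homs_def)
  have h: "f \<in> homs (simplices_over n \<F>) \<sigma> \<tau> \<longleftrightarrow> (\<exists>\<alpha>. f = (\<sigma>, \<alpha>, \<tau>) \<and> \<sigma> \<in> S \<and> \<tau> \<in> S \<and>
       \<alpha> \<in> homs Delta (Dom Delta \<sigma>) (Dom Delta \<tau>) \<and> \<tau> \<cdot>\<^bsub>Delta\<^esub> \<alpha> = \<sigma>)" for f \<sigma> \<tau>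
    unfolding homs_def[of "simplices_over n \<F>"]
    unfolding simplices_over_def S_def[symmetric] Let_def
    by auto
  show ?thesis
  proof
    fix f assume "f \<in> Arr (simplices_over n \<F>)"
    then show "Dom (simplices_over n \<F>) f \<in> Obj (simplices_over n \<F>)"
      "Cod (simplices_over n \<F>) f \<in> Obj (simplices_over n \<F>)"
      by (auto simp: simplices_over_def Let_def)
  next
    fix \<sigma> assume "\<sigma> \<in> Obj (simplices_over n \<F>)"
    then have \<sigma>: "\<sigma> \<in> S" by (simp add: simplices_over_def S_def Let_def)
    then have "Dom Delta \<sigma> \<in> Obj Delta" by (simp add: S_def D.Dom_Obj)
    with \<sigma> show "Ident (simplices_over n \<F>) \<sigma> \<in> homs (simplices_over n \<F>) \<sigma> \<sigma>"
      unfolding h using D.Ident_homs D.Ident_right[OF S[OF \<sigma>]]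
      by (auto simp: simplices_over_def Let_def)
  next
    fix g f \<rho> \<sigma> \<tau>
    assume "g \<in> homs (simplices_over n \<F>) \<sigma> \<tau>" "f \<in> homs (simplices_over n \<F>) \<rho> \<sigma>"
    then obtain \<beta> \<alpha> where gf: "g = (\<sigma>, \<beta>, \<tau>)" "f = (\<rho>, \<alpha>, \<sigma>)" and st: "\<rho> \<in> S" "\<tau> \<in> S"
      and \<beta>: "\<beta> \<in> homs Delta (Dom Delta \<sigma>) (Dom Delta \<tau>)" "\<tau> \<cdot>\<^bsub>Delta\<^esub> \<beta> = \<sigma>"
      and \<alpha>: "\<alpha> \<in> homs Delta (Dom Delta \<rho>) (Dom Delta \<sigma>)" "\<sigma> \<cdot>\<^bsub>Delta\<^esub> \<alpha> = \<rho>"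
      unfolding h by blast
    have "g \<cdot>\<^bsub>simplices_over n \<F>\<^esub> f = (\<rho>, \<beta> \<cdot>\<^bsub>Delta\<^esub> \<alpha>, \<tau>)"
      by (simp add: gf simplices_over_def Let_def)
    moreover have "\<beta> \<cdot>\<^bsub>Delta\<^esub> \<alpha> \<in> homs Delta (Dom Delta \<rho>) (Dom Delta \<tau>)"
      using \<alpha>(1) \<beta>(1) by (rule D.Comp_homs[rotated])
    moreover have "\<tau> \<cdot>\<^bsub>Delta\<^esub> (\<beta> \<cdot>\<^bsub>Delta\<^esub> \<alpha>) = \<rho>"
      using D.Comp_assoc[OF S[OF st(2)] \<beta>(1) \<alpha>(1)] \<alpha>(2) \<beta>(2) by simp
    ultimately show "g \<cdot>\<^bsub>simplices_over n \<F>\<^esub> f \<in> homs (simplices_over n \<F>) \<rho> \<tau>"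
      unfolding h using st by blast
  next
    fix f \<sigma> \<tau> assume "f \<in> homs (simplices_over n \<F>) \<sigma> \<tau>"
    then show "Ident (simplices_over n \<F>) \<tau> \<cdot>\<^bsub>simplices_over n \<F>\<^esub> f = f"
      "f \<cdot>\<^bsub>simplices_over n \<F>\<^esub> Ident (simplices_over n \<F>) \<sigma> = f"
      unfolding h by (auto simp: simplices_over_def Let_def D.Ident_left D.Ident_right)
  next
    fix k g f \<pi> \<rho> \<sigma> \<tau>
    assume "k \<in> homs (simplices_over n \<F>) \<sigma> \<tau>" "g \<in> homs (simplices_over n \<F>) \<rho> \<sigma>"
      "f \<in> homs (simplices_over n \<F>) \<pi> \<rho>"
    then show "(k \<cdot>\<^bsub>simplices_over n \<F>\<^esub> g) \<cdot>\<^bsub>simplices_over n \<F>\<^esub> f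
        = k \<cdot>\<^bsub>simplices_over n \<F>\<^esub> (g \<cdot>\<^bsub>simplices_over n \<F>\<^esub> f)"
      unfolding h by (auto simp: simplices_over_def Let_def D.Comp_assoc)
  qed
qed

lemma is_functor_simplices_diagram:
  assumes "simplicial_object A X"
  shows "is_functor (op_cat (simplices_over n \<F>)) A (comp_functor X simplices_forget)"
proof -
  have X: "fobj X k \<in> Obj A" "fmap X (Ident Delta k) = Ident A (fobj X k)" for k
    using assms by (auto simp: simplicial_object_def is_functor_def op_cat_def Delta_def)
  have ar: "fmap X f \<in> homs A (fobj X (Cod Delta f)) (fobj X (Dom Delta f))"
    if "f \<in> Arr Delta" for f
    using assms that by (auto simp: simplicial_object_def is_functor_def op_cat_def)
  have func: "fmap X (g \<cdot>\<^bsub>Delta\<^esub> f) = fmap X f \<cdot>\<^bsub>A\<^esub> fmap X g"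
    if "f \<in> Arr Delta" "g \<in> Arr Delta" "Cod Delta f = Dom Delta g" for f g
    using assms that by (auto simp: simplicial_object_def is_functor_def op_cat_def)
  have ar': "fmap X f \<in> homs A (fobj X b) (fobj X a)" if "f \<in> homs Delta a b" for f a b
    using ar[of f] that by (auto simp: homs_def)
  have func': "fmap X (g \<cdot>\<^bsub>Delta\<^esub> f) = fmap X f \<cdot>\<^bsub>A\<^esub> fmap X g"
    if "f \<in> homs Delta a b" "g \<in> homs Delta b c" for f g a b c
    using func[of f g] that by (auto simp: homs_def)
  show ?thesis
    unfolding is_functor_def
    by (auto simp: op_cat_def comp_functor_def simplices_forget_def simplices_over_def Let_def
        X ar' func')
qed

lemma is_X_over_canonical_cone:
  assumes "simplicial_object A X"
  shows "is_cone A (op_cat (simplices_over n \<F>)) (comp_functor X simplices_forget) (fobj X n)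
           (fmap X)"
proof -
  have func: "fmap X (g \<cdot>\<^bsub>Delta\<^esub> f) = fmap X f \<cdot>\<^bsub>A\<^esub> fmap X g"
    if "f \<in> Arr Delta" "g \<in> Arr Delta" "Cod Delta f = Dom Delta g" for f g
    using assms that by (auto simp: simplicial_object_def is_functor_def op_cat_def)
  have ob: "fobj X k \<in> Obj A" for k
    using assms by (auto simp: simplicial_object_def is_functor_def op_cat_def Delta_def)
  have ar: "fmap X f \<in> homs A (fobj X (Cod Delta f)) (fobj X (Dom Delta f))"
    if "f \<in> Arr Delta" for f
    using assms that by (auto simp: simplicial_object_def is_functor_def op_cat_def)
  show ?thesis
    unfolding is_cone_def
  proof (intro conjI ballI)
    show "fobj X n \<in> Obj A" by (rule ob)
  next
    fix \<sigma> assume "\<sigma> \<in> Obj (op_cat (simplices_over n \<F>))"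
    then have "\<sigma> \<in> Arr Delta" "Cod Delta \<sigma> = n"
      by (auto simp: op_cat_def simplices_over_def Let_def)
    then show "fmap X \<sigma> \<in> homs A (fobj X n) (fobj (comp_functor X simplices_forget) \<sigma>)"
      using ar[of \<sigma>] by (simp add: comp_functor_def simplices_forget_def)
  next
    let ?J = "op_cat (simplices_over n \<F>)"
    fix f assume f: "f \<in> Arr ?J"
    obtain \<sigma> \<alpha> \<tau> where [simp]: "f = (\<sigma>, \<alpha>, \<tau>)" by (cases f rule: prod_cases3)
    have D: "\<tau> \<in> Arr Delta" "\<alpha> \<in> Arr Delta" "Cod Delta \<alpha> = Dom Delta \<tau>" "\<tau> \<cdot>\<^bsub>Delta\<^esub> \<alpha> = \<sigma>"
      using f unfolding op_cat_def simplices_over_def Let_def homs_def by simp_all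
    have "fmap (comp_functor X simplices_forget) f = fmap X \<alpha>" "Dom ?J f = \<tau>" "Cod ?J f = \<sigma>"
      by (simp_all add: comp_functor_def simplices_forget_def op_cat_def simplices_over_def Let_def)
    then show "fmap (comp_functor X simplices_forget) f \<cdot>\<^bsub>A\<^esub> fmap X (Dom ?J f) = fmap X (Cod ?J f)"
      using func[OF D(2,1,3)] D(4) by simp
  qed
qed

context preadditive_category
begin

lemma homsD: "f \<in> homs A a b \<Longrightarrow> f \<in> Arr A \<and> Dom A f = a \<and> Cod A f = b \<and> a \<in> Obj A \<and> b \<in> Obj A"
  by (auto simp: homs_def Dom_Obj Cod_Obj)

lemma mono_cancel:
  assumes "mono_arr A k" "u \<in> homs A a (Dom A k)" "v \<in> homs A a (Dom A k)" "k \<cdot> u = k \<cdot> v"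
  shows "u = v"
  using assms homsD[OF assms(2)] unfolding mono_arr_def by meson

lemma hom_zero_homs: "\<lbrakk>a \<in> Obj A; b \<in> Obj A\<rbrakk> \<Longrightarrow> hom_zero A a b \<in> homs A a b"
  using hom_comm_group[of a b]
  by (metis comm_group_def group.is_monoid hom_group_def monoid.one_closed monoid.simps(2)
      partial_object.select_convs(1))

lemma hom_add_idem:
  assumes "f \<in> homs A a b" "hom_add A f f = f"
  shows "f = hom_zero A a b"
proof -
  have "comm_group (hom_group A a b)"
    using assms homsD hom_comm_group by blast
  then interpret G: comm_group "hom_group A a b" .
  show ?thesis
    using assms G.l_cancel_one[of f f] by (simp add: hom_group_def)
qed

lemma hom_add_zero_zero:
  assumes "a \<in> Obj A" "b \<in> Obj A"
  shows "hom_add A (hom_zero A a b) (hom_zero A a b) = hom_zero A a b"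
proof -
  interpret G: comm_group "hom_group A a b" using assms by (rule hom_comm_group)
  show ?thesis using G.l_one[OF G.one_closed] by (simp add: hom_group_def)
qed

lemma zero_Comp:
  assumes "f \<in> homs A a b" "c \<in> Obj A"
  shows "hom_zero A b c \<cdot> f = hom_zero A a c"
proof (rule hom_add_idem)
  have z: "hom_zero A b c \<in> homs A b c" using assms homsD hom_zero_homs by blast
  then show "hom_zero A b c \<cdot> f \<in> homs A a c" using assms Comp_homs by blast
  show "hom_add A (hom_zero A b c \<cdot> f) (hom_zero A b c \<cdot> f) = hom_zero A b c \<cdot> f"
    using Comp_add_left[OF z z assms(1)] hom_add_zero_zero assms homsD by metis
qed

lemma Comp_zero:
  assumes "g \<in> homs A b c" "a \<in> Obj A"
  shows "g \<cdot> hom_zero A a b = hom_zero A a c"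
proof (rule hom_add_idem)
  have z: "hom_zero A a b \<in> homs A a b" using assms homsD hom_zero_homs by blast
  then show "g \<cdot> hom_zero A a b \<in> homs A a c" using assms Comp_homs by blast
  show "hom_add A (g \<cdot> hom_zero A a b) (g \<cdot> hom_zero A a b) = g \<cdot> hom_zero A a b"
    using Comp_add_right[OF assms(1) z z] hom_add_zero_zero assms homsD by metis
qed

lemma is_kernel_mono:
  assumes "f \<in> homs A x y" "is_kernel A f k"
  shows "mono_arr A k"
  unfolding mono_arr_def
proof (intro conjI ballI impI)
  show "k \<in> Arr A" using assms by (simp add: is_kernel_def)
next
  fix a g h
  assume a: "a \<in> Obj A" and g: "g \<in> homs A a (Dom A k)" and h: "h \<in> homs A a (Dom A k)"
    and eq: "k \<cdot> g = k \<cdot> h"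
  have x: "Dom A f = x" "Cod A f = y" "y \<in> Obj A" using assms homsD by blast+
  have k: "k \<in> homs A (Dom A k) x" using assms x by (simp add: is_kernel_def homs_def)
  have kg: "k \<cdot> g \<in> homs A a x" using Comp_homs k g by blast
  have "f \<cdot> (k \<cdot> g) = (f \<cdot> k) \<cdot> g" using Comp_assoc[OF assms(1) k g] by simp
  also have "\<dots> = hom_zero A a y"
    using assms(2) x zero_Comp[OF g] by (simp add: is_kernel_def)
  finally have "\<exists>!u. u \<in> homs A a (Dom A k) \<and> k \<cdot> u = k \<cdot> g"
    using assms(2) a kg x unfolding is_kernel_def by metis
  then show "g = h" using g h eq by metis
qed

end

context abelian_category
begin

lemma is_kernel_kernel: "f \<in> Arr A \<Longrightarrow> is_kernel A f (kernel_arr A f)"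
  unfolding kernel_arr_def by (rule someI_ex) (rule ex_kernel)

lemma kernel_homs: "f \<in> homs A x y \<Longrightarrow> kernel_arr A f \<in> homs A (Dom A (kernel_arr A f)) x"
  using is_kernel_kernel[of f] by (auto simp: homs_def is_kernel_def)

lemma factors_through_kernel:
  assumes f: "f \<in> homs A x y" and h: "h \<in> homs A a x"
  shows "factors_through A h (kernel_arr A f) \<longleftrightarrow> f \<cdot> h = hom_zero A a y"
proof -
  have xy: "f \<in> Arr A" "Dom A f = x" "Cod A f = y" "y \<in> Obj A" using f homsD by blast+
  have a: "a \<in> Obj A" "Dom A h = a" using h homsD by blast+
  have k: "kernel_arr A f \<in> homs A (Dom A (kernel_arr A f)) x" using f by (rule kernel_homs)
  have K: "is_kernel A f (kernel_arr A f)" using xy by (simp add: is_kernel_kernel)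
  show ?thesis
  proof
    assume "factors_through A h (kernel_arr A f)"
    then obtain u where u: "u \<in> homs A a (Dom A (kernel_arr A f))" "kernel_arr A f \<cdot> u = h"
      using a by (auto simp: factors_through_def)
    have "f \<cdot> h = (f \<cdot> kernel_arr A f) \<cdot> u" using Comp_assoc[OF f k u(1)] u by simp
    then show "f \<cdot> h = hom_zero A a y"
      using K xy zero_Comp[OF u(1)] by (simp add: is_kernel_def)
  next
    assume "f \<cdot> h = hom_zero A a y"
    then have "\<exists>!u. u \<in> homs A a (Dom A (kernel_arr A f)) \<and> kernel_arr A f \<cdot> u = h"
      using K a h xy unfolding is_kernel_def by metis
    then show "factors_through A h (kernel_arr A f)"
      using a by (auto simp: factors_through_def)
  qed
qed

lemma ex_intersection_kernels:
  fixes n :: nat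
  assumes x: "x \<in> Obj A" and f: "\<And>i. i \<in> {1..n} \<Longrightarrow> f i \<in> homs A x (y i)"
  shows "\<exists>k. is_intersection A x ((\<lambda>i. kernel_arr A (f i)) ` {1..n}) k"
  using f
proof (induction n)
  case 0
  have I: "Ident A x \<in> homs A x x" using x by (rule Ident_homs)
  have "is_intersection A x {} (Ident A x)"
    using I homsD[OF I]
    by (auto simp: is_intersection_def mono_arr_def factors_through_def Ident_left homs_def)
  then show ?case by auto
next
  case (Suc n)
  then obtain k where k: "is_intersection A x ((\<lambda>i. kernel_arr A (f i)) ` {1..n}) k"
    by auto
  have km: "mono_arr A k" using k by (simp add: is_intersection_def)
  define g where "g = f (Suc n)"
  define z where "z = y (Suc n)"
  have g: "g \<in> homs A x z" using Suc.prems by (simp add: g_def z_def)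
  have kx: "k \<in> homs A (Dom A k) x" using k by (simp add: is_intersection_def mono_arr_def homs_def)
  have gk: "g \<cdot> k \<in> homs A (Dom A k) z" using Comp_homs g kx by blast
  define l where "l = kernel_arr A (g \<cdot> k)"
  have l: "l \<in> homs A (Dom A l) (Dom A k)" unfolding l_def using gk by (rule kernel_homs)
  have lm: "mono_arr A l" unfolding l_def using is_kernel_mono[OF gk] is_kernel_kernel homsD[OF gk] by blast
  have kl: "k \<cdot> l \<in> homs A (Dom A l) x" using Comp_homs kx l by blast
  have S: "(\<lambda>i. kernel_arr A (f i)) ` {1..Suc n} = insert (kernel_arr A g) ((\<lambda>i. kernel_arr A (f i)) ` {1..n})"
    using atLeastAtMostSuc_conv[of 1 n] by (simp add: g_def)
  have mono: "mono_arr A (k \<cdot> l)"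
    unfolding mono_arr_def
  proof (intro conjI ballI impI)
    show "k \<cdot> l \<in> Arr A" using homsD[OF kl] by simp
  next
    fix a u v
    assume a: "a \<in> Obj A" and "u \<in> homs A a (Dom A (k \<cdot> l))" "v \<in> homs A a (Dom A (k \<cdot> l))"
      and eq: "k \<cdot> l \<cdot> u = k \<cdot> l \<cdot> v"
    then have uv: "u \<in> homs A a (Dom A l)" "v \<in> homs A a (Dom A l)" using homsD[OF kl] by auto
    have "k \<cdot> (l \<cdot> u) = k \<cdot> (l \<cdot> v)" using eq Comp_assoc[OF kx l] uv by simp
    then have "l \<cdot> u = l \<cdot> v"
      using mono_cancel[OF km] Comp_homs[OF l uv(1)] Comp_homs[OF l uv(2)] by simp
    then show "u = v" using mono_cancel[OF lm] uv by simp
  qed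
  have fac: "factors_through A (k \<cdot> l) (kernel_arr A (f i))" if i: "i \<in> {1..n}" for i
  proof -
    have fi: "f i \<in> homs A x (y i)" using Suc.prems i by simp
    have "factors_through A k (kernel_arr A (f i))" using k i by (simp add: is_intersection_def)
    then have "f i \<cdot> k = hom_zero A (Dom A k) (y i)" using factors_through_kernel[OF fi kx] by simp
    then have "f i \<cdot> (k \<cdot> l) = hom_zero A (Dom A l) (y i)"
      using Comp_assoc[OF fi kx l] zero_Comp[OF l] homsD[OF fi] by simp
    then show ?thesis using factors_through_kernel[OF fi kl] by simp
  qed
  have "factors_through A l l"
    unfolding factors_through_def using Ident_homs Ident_right[OF l] homsD[OF l] by blast
  then have "(g \<cdot> k) \<cdot> l = hom_zero A (Dom A l) z"
    using factors_through_kernel[OF gk l] by (simp add: l_def)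
  then have facg: "factors_through A (k \<cdot> l) (kernel_arr A g)"
    using factors_through_kernel[OF g kl] Comp_assoc[OF g kx l] by simp
  have univ: "factors_through A h (k \<cdot> l)"
    if h: "h \<in> homs A a x" and hS: "\<forall>s \<in> insert (kernel_arr A g) ((\<lambda>i. kernel_arr A (f i)) ` {1..n}). factors_through A h s"
    for a h
  proof -
    have "factors_through A h k" using k h hS homsD[OF h] by (auto simp: is_intersection_def)
    then obtain u where u: "u \<in> homs A a (Dom A k)" "k \<cdot> u = h"
      using homsD[OF h] by (auto simp: factors_through_def)
    have "g \<cdot> h = hom_zero A a z" using hS factors_through_kernel[OF g h] by simp
    then have "(g \<cdot> k) \<cdot> u = hom_zero A a z" using u Comp_assoc[OF g kx u(1)] by simp
    then have "factors_through A u l" using factors_through_kernel[OF gk u(1)] by (simp add: l_def)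
    then obtain w where w: "w \<in> homs A a (Dom A l)" "l \<cdot> w = u"
      using homsD[OF u(1)] by (auto simp: factors_through_def)
    then have "(k \<cdot> l) \<cdot> w = h" using u Comp_assoc[OF kx l w(1)] by simp
    then show ?thesis using w homsD[OF h] homsD[OF kl] by (auto simp: factors_through_def)
  qed
  show ?case unfolding S
    using mono fac facg univ homsD[OF kl] by (intro exI[of _ "k \<cdot> l"]) (auto simp: is_intersection_def)
qed

end

lemma coface_homs:
  assumes "n \<ge> 1"
  shows "coface n i \<in> homs Delta (n - 1) n"
  using assms by (auto simp: Delta_homs coface_def mono_on_def split: if_splits)

lemma coface_coface:
  assumes "n \<ge> 2"
  shows "coface n 0 \<cdot>\<^bsub>Delta\<^esub> coface (n - 1) i = coface n (i + 1) \<cdot>\<^bsub>Delta\<^esub> coface (n - 1) 0"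
  using assms by (auto simp: coface_def Delta_def compose_def fun_eq_iff)

text \<open>The normalised Moore complex exists and is a connective chain complex.\<close>

context
  fixes A :: "('o, 'm, 'x) ab_cat_scheme" (structure) and X :: "('o, 'm) sobj"
  assumes abelian: "abelian_category A" and simplicial: "simplicial_object A X"
begin

interpretation abelian_category A by (fact abelian)

lemma simplicial_object_obj: "fobj X n \<in> Obj A"
  using simplicial by (simp add: simplicial_object_def is_functor_def op_cat_def Delta_def)

lemma face_homs: "n \<ge> 1 \<Longrightarrow> face X n i \<in> homs A (fobj X n) (fobj X (n - 1))"
  using simplicial coface_homs[of n i]
  by (auto simp: simplicial_object_def is_functor_def op_cat_def homs_def face_def)

lemma face_face:
  assumes "n \<ge> 2"
  shows "face X (n - 1) i \<cdot> face X n 0 = face X (n - 1) 0 \<cdot> face X n (i + 1)"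
proof -
  have f: "fmap X (g \<cdot>\<^bsub>Delta\<^esub> f) = fmap X f \<cdot> fmap X g"
    if "f \<in> homs Delta a b" "g \<in> homs Delta b c" for f g a b c
    using simplicial that by (auto simp: simplicial_object_def is_functor_def op_cat_def homs_def)
  have c: "coface (n - 1) j \<in> homs Delta (n - 2) (n - 1)" "coface n j \<in> homs Delta (n - 1) n" for j
    using assms coface_homs[of "n - 1" j] coface_homs[of n j] by (simp_all add: numeral_2_eq_2)
  show ?thesis
    using coface_coface[OF assms, of i] f[OF c(1) c(2), symmetric] by (simp add: face_def)
qed

lemma is_intersection_moore_incl:
  "is_intersection A (fobj X n) ((\<lambda>i. kernel_arr A (face X n i)) ` {1..n}) (moore_incl A X n)"
  unfolding moore_incl_def intersection_arr_def
proof (rule someI_ex, rule ex_intersection_kernels)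
  show "fobj X n \<in> Obj A" by (rule simplicial_object_obj)
  show "face X n i \<in> homs A (fobj X n) (fobj X (n - 1))" if "i \<in> {1..n}" for i
    using that face_homs by simp
qed

lemma moore_incl_homs: "moore_incl A X n \<in> homs A (chain_obj (moore_complex A X) n) (fobj X n)"
  using is_intersection_moore_incl[of n]
  by (simp add: is_intersection_def mono_arr_def homs_def moore_complex_def)

lemma moore_incl_cancel:
  assumes "u \<in> homs A a (chain_obj (moore_complex A X) n)" "v \<in> homs A a (chain_obj (moore_complex A X) n)"
    and "moore_incl A X n \<cdot> u = moore_incl A X n \<cdot> v"
  shows "u = v"
proof (rule mono_cancel)
  show "mono_arr A (moore_incl A X n)"
    using is_intersection_moore_incl[of n] by (simp add: is_intersection_def)
qed (use assms in \<open>simp_all add: moore_complex_def\<close>)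

lemma face_moore_incl:
  assumes "i \<in> {1..n}"
  shows "face X n i \<cdot> moore_incl A X n = hom_zero A (chain_obj (moore_complex A X) n) (fobj X (n - 1))"
proof -
  have "n \<ge> 1" using assms by simp
  then show ?thesis
    using factors_through_kernel[OF face_homs moore_incl_homs] is_intersection_moore_incl[of n] assms
    by (auto simp: is_intersection_def)
qed

lemma moore_diff:
  assumes n: "n \<ge> 1"
  shows "chain_diff (moore_complex A X) n
           \<in> homs A (chain_obj (moore_complex A X) n) (chain_obj (moore_complex A X) (n - 1))"
    and "moore_incl A X (n - 1) \<cdot> chain_diff (moore_complex A X) n = face X n 0 \<cdot> moore_incl A X n"
proof -
  let ?Y = "chain_obj (moore_complex A X)"
  let ?h = "face X n 0 \<cdot> moore_incl A X n"
  let ?P = "\<lambda>d. d \<in> homs A (?Y n) (?Y (n - 1)) \<and> moore_incl A X (n - 1) \<cdot> d = ?h"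
  have h: "?h \<in> homs A (?Y n) (fobj X (n - 1))"
    using Comp_homs[OF face_homs[OF n] moore_incl_homs] .
  have "factors_through A ?h (kernel_arr A (face X (n - 1) i))" if i: "i \<in> {1..n - 1}" for i
  proof -
    have n2: "n \<ge> 2" "n - 1 \<ge> 1" "i + 1 \<in> {1..n}" using i by auto
    have "face X (n - 1) i \<cdot> ?h = (face X (n - 1) i \<cdot> face X n 0) \<cdot> moore_incl A X n"
      using Comp_assoc[OF face_homs[OF n2(2)] face_homs[OF n] moore_incl_homs] by simp
    also have "\<dots> = face X (n - 1) 0 \<cdot> (face X n (i + 1) \<cdot> moore_incl A X n)"
      using face_face[OF n2(1)] Comp_assoc[OF face_homs[OF n2(2)] face_homs[OF n] moore_incl_homs] by simp
    also have "\<dots> = hom_zero A (?Y n) (fobj X (n - 1 - 1))"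
      using face_moore_incl[OF n2(3)] Comp_zero[OF face_homs[OF n2(2)]] homsD[OF moore_incl_homs] by simp
    finally show ?thesis using factors_through_kernel[OF face_homs[OF n2(2)] h] by simp
  qed
  then have "factors_through A ?h (moore_incl A X (n - 1))"
    using is_intersection_moore_incl[of "n - 1"] h homsD[OF h] by (auto simp: is_intersection_def)
  then obtain d where d: "?P d"
    using homsD[OF h] homsD[OF moore_incl_homs[of "n - 1"]] by (auto simp: factors_through_def)
  have "?P (THE d. ?P d)"
    using d by (rule theI) (use d moore_incl_cancel in metis)
  moreover have "chain_diff (moore_complex A X) n = (THE d. ?P d)"
    by (simp add: moore_complex_def)
  ultimately show "chain_diff (moore_complex A X) n \<in> homs A (?Y n) (?Y (n - 1))"
    "moore_incl A X (n - 1) \<cdot> chain_diff (moore_complex A X) n = ?h"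
    by simp_all
qed

lemma chain_complex_moore_complex: "chain_complex A (moore_complex A X)"
  unfolding chain_complex_def
proof (intro conjI allI impI)
  fix n
  show "chain_obj (moore_complex A X) n \<in> Obj A" using homsD[OF moore_incl_homs] by blast
  show "chain_diff (moore_complex A X) n
      \<in> homs A (chain_obj (moore_complex A X) n) (chain_obj (moore_complex A X) (n - 1))" if "1 \<le> n"
    using moore_diff(1)[OF that] .
  assume n: "2 \<le> n"
  let ?Y = "chain_obj (moore_complex A X)"
  let ?d = "chain_diff (moore_complex A X)"
  let ?i = "moore_incl A X"
  have n1: "n \<ge> 1" "n - 1 \<ge> 1" "n - 1 - 1 = n - 2" using n by auto
  note d1 = moore_diff[OF n1(1)] and d2 = moore_diff[OF n1(2), unfolded n1(3)]
  note i = moore_incl_homs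
  note f1 = face_homs[OF n1(1)] and f2 = face_homs[OF n1(2), unfolded n1(3)]
  have ob: "?Y k \<in> Obj A" for k using homsD[OF i] by blast
  show "?d (n - 1) \<cdot> ?d n = hom_zero A (?Y n) (?Y (n - 2))"
  proof (rule moore_incl_cancel)
    show "?d (n - 1) \<cdot> ?d n \<in> homs A (?Y n) (?Y (n - 2))" using Comp_homs[OF d2(1) d1(1)] .
    show "hom_zero A (?Y n) (?Y (n - 2)) \<in> homs A (?Y n) (?Y (n - 2))" using hom_zero_homs ob by blast
    have "?i (n - 2) \<cdot> (?d (n - 1) \<cdot> ?d n) = face X (n - 1) 0 \<cdot> (?i (n - 1) \<cdot> ?d n)"
      using Comp_assoc[OF i d2(1) d1(1)] Comp_assoc[OF f2 i d1(1)] d2(2) by simp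
    also have "\<dots> = face X (n - 1) 0 \<cdot> (face X n 1 \<cdot> ?i n)"
      using Comp_assoc[OF f2 f1 i, symmetric] d1(2) face_face[OF n, of 0] by simp
    also have "\<dots> = hom_zero A (?Y n) (fobj X (n - 2))"
      using face_moore_incl[of 1 n] n Comp_zero[OF f2 ob] by simp
    also have "\<dots> = ?i (n - 2) \<cdot> hom_zero A (?Y n) (?Y (n - 2))"
      using Comp_zero[OF i ob] by simp
    finally show "?i (n - 2) \<cdot> (?d (n - 1) \<cdot> ?d n) = ?i (n - 2) \<cdot> hom_zero A (?Y n) (?Y (n - 2))" .
  qed
qed

end

end

theory Submission
  imports Defs
begin

text \<open>
  All three conditions are statements about limits: descent says that \<open>X\<^sub>n\<close> is a limit of a diagram, and
  the Moore complex is formed with kernels and intersections. They can therefore be tested on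
  generalised elements, that is, on the simplicial abelian groups \<open>Hom(T, X)\<close> for all objects \<open>T\<close>
  (\<open>descent_iff_glues\<close>, \<open>truncated_iff_cycles_trivial\<close>). For a simplicial abelian group \<open>G\<close>, let
  \<open>N\<^sub>n\<close> consist of the \<open>x \<in> G\<^sub>n\<close> with \<open>d\<^sub>1 x = \<dots> = d\<^sub>n x = 0\<close>.

  If \<open>N\<^sub>k = 0\<close> for all \<open>k > m\<close>, then descent holds for every family \<open>\<F>\<close> of subsets of \<open>[n]\<close> which is a cone
  with apex \<open>0\<close> (all members contain \<open>0\<close>) and whose members cover all subsets of \<open>{1..n}\<close> with at most
  \<open>m\<close> elements (\<open>cone_glues\<close>). Matching families on a cone extend over any simplicial abelian group, and
  the extension is unique since the faces spanned by \<open>0\<close> and at most \<open>m\<close> further vertices determine an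
  element. The horn at \<open>0\<close> with \<open>n > m\<close> and the lower \<open>2m\<close>-Segal cover with \<open>n \<ge> 2m\<close> are such families:
  a lower Segal set is \<open>{0}\<close> together with \<open>m\<close> disjoint pairs of neighbours, and any \<open>m\<close> vertices are
  covered by \<open>m\<close> such pairs. Reversing the order of the vertices yields the horn at \<open>n\<close> and the upper
  cover. Here the hypothesis has to be known for the reversed Moore complex, defined by
  \<open>d\<^sub>0, \<dots>, d\<^bsub>n-1\<^esub>\<close>, and this follows by moving the omitted face from \<open>d\<^sub>0\<close> to \<open>d\<^sub>n\<close> one step at a time
  (\<open>cycles_Suc\<close>).

  Conversely, let \<open>x \<in> N\<^sub>k\<close> with \<open>k > m\<close>. All simplices of the horn at \<open>0\<close> in \<open>[k]\<close> miss a vertex \<open>j \<ge> 1\<close>,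
  so \<open>x\<close> restricts to zero on it, and descent for this horn forces \<open>x = 0\<close>. For the lower Segal covers,
  the element \<open>y = (s\<^bsub>2k-3\<^esub> - s\<^bsub>2k-4\<^esub>) \<dots> (s\<^sub>1 - s\<^sub>0) x\<close> of \<open>G\<^bsub>2k-1\<^esub>\<close> takes the role of \<open>x\<close>
  (\<open>ex_element_killed_by_odd_faces\<close>): it is killed by all odd faces, every lower set in \<open>[2k - 1]\<close> misses
  an odd vertex, so \<open>y = 0\<close>, and \<open>x\<close> is an iterated face of \<open>y\<close>.
\<close>

section \<open>Monotone maps\<close>

text \<open>A map \<open>[k] \<rightarrow> [n]\<close> is represented by a function whose values outside \<open>[k]\<close> are arbitrary, so
  that composition of maps is plain composition of functions.\<close>

definition monotone_map :: "nat \<Rightarrow> nat \<Rightarrow> (nat \<Rightarrow> nat) \<Rightarrow> bool" where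
  "monotone_map k n \<phi> \<longleftrightarrow> (\<forall>i\<le>k. \<phi> i \<le> n) \<and> (\<forall>i j. i \<le> j \<longrightarrow> j \<le> k \<longrightarrow> \<phi> i \<le> \<phi> j)"

definition simplex_over :: "nat \<Rightarrow> nat set set \<Rightarrow> nat \<Rightarrow> (nat \<Rightarrow> nat) \<Rightarrow> bool" where
  "simplex_over n \<F> k \<sigma> \<longleftrightarrow> monotone_map k n \<sigma> \<and> (\<exists>f \<in> \<F>. \<sigma> ` {0..k} \<subseteq> f)"

text \<open>The map \<open>skip j\<close> is the \<open>j\<close>-th coface, \<open>merge j\<close> the \<open>j\<close>-th codegeneracy.\<close>

definition skip :: "nat \<Rightarrow> nat \<Rightarrow> nat" where
  "skip j i = (if i < j then i else i + 1)"

definition merge :: "nat \<Rightarrow> nat \<Rightarrow> nat" where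
  "merge j i = (if i \<le> j then i else i - 1)"

lemma monotone_map_id: "monotone_map n n (\<lambda>i. i)"
  by (auto simp: monotone_map_def)

lemma monotone_map_comp:
  assumes "monotone_map k l \<phi>" "monotone_map l n \<psi>"
  shows "monotone_map k n (\<lambda>i. \<psi> (\<phi> i))"
  using assms by (auto simp: monotone_map_def)

lemma monotone_map_skip: "n \<ge> 1 \<Longrightarrow> monotone_map (n - 1) n (skip j)"
  by (auto simp: monotone_map_def skip_def)

lemma monotone_map_merge: "i \<le> n \<Longrightarrow> monotone_map (Suc n) n (merge i)"
  by (auto simp: monotone_map_def merge_def)

lemma monotone_map_merge_comp:
  assumes "monotone_map k n \<tau>" "\<And>i. i \<le> k \<Longrightarrow> \<tau> i \<noteq> j" "j \<le> n" "n \<ge> 1"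
  shows "monotone_map k (n - 1) (\<lambda>i. merge j (\<tau> i))"
  unfolding monotone_map_def
proof (intro conjI allI impI)
  fix i assume "i \<le> k"
  then have "\<tau> i \<le> n" "\<tau> i \<noteq> j" using assms by (auto simp: monotone_map_def)
  then show "merge j (\<tau> i) \<le> n - 1" using assms by (auto simp: merge_def)
next
  fix i i' assume "i \<le> i'" "i' \<le> k"
  then have "\<tau> i \<le> \<tau> i'" using assms by (auto simp: monotone_map_def)
  then show "merge j (\<tau> i) \<le> merge j (\<tau> i')" by (auto simp: merge_def)
qed

lemma skip_merge: "i \<noteq> j \<Longrightarrow> skip j (merge j i) = i"
  by (auto simp: skip_def merge_def)

text \<open>The retraction onto \<open>{0} \<union> U\<close> that rounds down. Its composites stay inside the monoid of
  monotone endomaps of \<open>[n]\<close>, so faces of varying dimension can be handled without renumbering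
  their vertices.\<close>

definition round_down :: "nat set \<Rightarrow> nat \<Rightarrow> nat" where
  "round_down U i = Max {u \<in> insert 0 U. u \<le> i}"

lemma round_down_in: "round_down U i \<in> insert 0 U" and round_down_le: "round_down U i \<le> i"
proof -
  have "finite {u \<in> insert 0 U. u \<le> i}" "{u \<in> insert 0 U. u \<le> i} \<noteq> {}" by auto
  from Max_in[OF this] show "round_down U i \<in> insert 0 U" "round_down U i \<le> i"
    by (auto simp: round_down_def)
qed

lemma round_down_fixes: "i \<in> insert 0 U \<Longrightarrow> round_down U i = i"
  unfolding round_down_def by (rule Max_eqI) auto

lemma round_down_mono: "i \<le> j \<Longrightarrow> round_down U i \<le> round_down U j"
  unfolding round_down_def by (rule Max_mono) auto

lemma monotone_map_round_down: "monotone_map n n (round_down U)"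
  using round_down_le round_down_mono by (auto simp: monotone_map_def intro: le_trans)

text \<open>Rounding down decreases vertices, so a set \<open>V\<close> that is rounded onto all of \<open>U\<close> has the
  larger sum. This makes the sum of the vertices the right order in which to treat faces.\<close>

lemma round_down_onto_imp_eq:
  fixes U V :: "nat set"
  assumes fin: "finite V" and pos: "0 \<notin> U" "0 \<notin> V"
    and onto: "U \<subseteq> round_down U ` V" and le: "\<Sum>V \<le> \<Sum>U"
  shows "V = U"
proof -
  let ?r = "round_down U"
  have "\<Sum>U \<le> \<Sum>(?r ` V)" using onto fin by (intro sum_mono2) auto
  also have "\<dots> \<le> sum ?r V" using sum_image_le[OF fin, of "\<lambda>x. x" ?r] by simp
  finally have lower: "\<Sum>U \<le> sum ?r V" .
  have fixed: "?r v = v" if "v \<in> V" for v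
  proof (rule ccontr)
    assume "?r v \<noteq> v"
    then have "?r v < v" using round_down_le[of U v] by simp
    then have "sum ?r V < \<Sum>V"
      using that fin round_down_le[of U] by (intro sum_strict_mono_ex1) auto
    then show False using lower le by simp
  qed
  have sub: "V \<subseteq> U"
  proof
    fix v assume "v \<in> V"
    then show "v \<in> U" using round_down_in[of U v] fixed[of v] pos by auto
  qed
  moreover have "U \<subseteq> V" using onto fixed by force
  ultimately show ?thesis by blast
qed

text \<open>The map that \<open>\<phi>\<close> induces between the opposites of the ordered sets \<open>[k]\<close> and \<open>[n]\<close>.\<close>

definition reverse_map :: "nat \<Rightarrow> nat \<Rightarrow> (nat \<Rightarrow> nat) \<Rightarrow> nat \<Rightarrow> nat" where
  "reverse_map k n \<phi> = (\<lambda>i. n - \<phi> (k - i))"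

lemma monotone_map_reverse: "monotone_map k n \<phi> \<Longrightarrow> monotone_map k n (reverse_map k n \<phi>)"
  by (auto simp: monotone_map_def reverse_map_def intro!: diff_le_mono2)

lemma reverse_reverse_map:
  "monotone_map k n \<phi> \<Longrightarrow> i \<le> k \<Longrightarrow> reverse_map k n (reverse_map k n \<phi>) i = \<phi> i"
  by (auto simp: monotone_map_def reverse_map_def)

section \<open>Simplicial abelian groups\<close>

locale simplicial_abelian_group =
  fixes G :: "nat \<Rightarrow> 'g monoid" and act :: "nat \<Rightarrow> nat \<Rightarrow> (nat \<Rightarrow> nat) \<Rightarrow> 'g \<Rightarrow> 'g"
  assumes comm_group: "comm_group (G n)"
    and act_hom: "monotone_map k n \<phi> \<Longrightarrow> act k n \<phi> \<in> hom (G n) (G k)"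
    and act_id: "x \<in> carrier (G n) \<Longrightarrow> act n n (\<lambda>i. i) x = x"
    and act_comp: "\<lbrakk>monotone_map k l \<phi>; monotone_map l n \<psi>; x \<in> carrier (G n);
        \<And>i. i \<le> k \<Longrightarrow> \<chi> i = \<psi> (\<phi> i)\<rbrakk> \<Longrightarrow> act k l \<phi> (act l n \<psi> x) = act k n \<chi> x"
begin

text \<open>The limit over \<open>\<Delta>\<^bsub>/\<F>\<^esub>\<close>, elementwise. Taking \<open>\<alpha>\<close> to be an identity shows that a matching family
  only depends on the values of \<open>\<sigma>\<close> on \<open>[k]\<close>.\<close>

definition matching :: "nat \<Rightarrow> nat set set \<Rightarrow> (nat \<Rightarrow> (nat \<Rightarrow> nat) \<Rightarrow> 'g) \<Rightarrow> bool" where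
  "matching n \<F> c \<longleftrightarrow>
     (\<forall>k \<sigma>. simplex_over n \<F> k \<sigma> \<longrightarrow> c k \<sigma> \<in> carrier (G k)) \<and>
     (\<forall>k l \<alpha> \<tau> \<sigma>. simplex_over n \<F> l \<tau> \<longrightarrow> simplex_over n \<F> k \<sigma> \<longrightarrow> monotone_map k l \<alpha> \<longrightarrow>
        (\<forall>i\<le>k. \<sigma> i = \<tau> (\<alpha> i)) \<longrightarrow> act k l \<alpha> (c l \<tau>) = c k \<sigma>)"

definition glues :: "nat \<Rightarrow> nat set set \<Rightarrow> bool" where
  "glues n \<F> \<longleftrightarrow> (\<forall>c. matching n \<F> c \<longrightarrow>
     (\<exists>!x. x \<in> carrier (G n) \<and> (\<forall>k \<sigma>. simplex_over n \<F> k \<sigma> \<longrightarrow> act k n \<sigma> x = c k \<sigma>)))"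

lemma matching_closed: "matching n \<F> c \<Longrightarrow> simplex_over n \<F> k \<sigma> \<Longrightarrow> c k \<sigma> \<in> carrier (G k)"
  by (simp add: matching_def)

lemma matching_comp:
  "\<lbrakk>matching n \<F> c; simplex_over n \<F> l \<tau>; simplex_over n \<F> k \<sigma>; monotone_map k l \<alpha>;
     \<forall>i\<le>k. \<sigma> i = \<tau> (\<alpha> i)\<rbrakk> \<Longrightarrow> act k l \<alpha> (c l \<tau>) = c k \<sigma>"
  unfolding matching_def by blast

text \<open>For \<open>r = 0\<close> these are the elements of the normalised Moore complex in degree \<open>n\<close>.\<close>

definition cycles :: "nat \<Rightarrow> nat \<Rightarrow> 'g set" where
  "cycles r n = {x \<in> carrier (G n). \<forall>j\<le>n. j \<noteq> r \<longrightarrow> act (n - 1) n (skip j) x = \<one>\<^bsub>G (n - 1)\<^esub>}"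

interpretation grp: comm_group "G n" for n by (rule comm_group)

lemma act_closed: "monotone_map k n \<phi> \<Longrightarrow> x \<in> carrier (G n) \<Longrightarrow> act k n \<phi> x \<in> carrier (G k)"
  using act_hom[of k n \<phi>] by (auto simp: hom_def)

lemma act_mult:
  "\<lbrakk>monotone_map k n \<phi>; x \<in> carrier (G n); y \<in> carrier (G n)\<rbrakk>
     \<Longrightarrow> act k n \<phi> (x \<otimes>\<^bsub>G n\<^esub> y) = act k n \<phi> x \<otimes>\<^bsub>G k\<^esub> act k n \<phi> y"
  using act_hom[of k n \<phi>] by (auto simp: hom_def)

lemma act_group_hom: "monotone_map k n \<phi> \<Longrightarrow> group_hom (G n) (G k) (act k n \<phi>)"
  by (intro group_hom.intro group_hom_axioms.intro act_hom grp.is_group)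

lemma act_one: "monotone_map k n \<phi> \<Longrightarrow> act k n \<phi> \<one>\<^bsub>G n\<^esub> = \<one>\<^bsub>G k\<^esub>"
  using group_hom.hom_one[OF act_group_hom] .

lemma act_inv:
  "\<lbrakk>monotone_map k n \<phi>; x \<in> carrier (G n)\<rbrakk> \<Longrightarrow> act k n \<phi> (inv\<^bsub>G n\<^esub> x) = inv\<^bsub>G k\<^esub> act k n \<phi> x"
  using group_hom.hom_inv[OF act_group_hom] .

lemma act_div:
  "\<lbrakk>monotone_map k n \<phi>; x \<in> carrier (G n); y \<in> carrier (G n)\<rbrakk>
     \<Longrightarrow> act k n \<phi> (x \<otimes>\<^bsub>G n\<^esub> inv\<^bsub>G n\<^esub> y) = act k n \<phi> x \<otimes>\<^bsub>G k\<^esub> inv\<^bsub>G k\<^esub> act k n \<phi> y"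
  by (simp add: act_mult act_inv)

lemma act_cong:
  assumes "monotone_map k n \<phi>" "x \<in> carrier (G n)" "\<And>i. i \<le> k \<Longrightarrow> \<chi> i = \<phi> i"
  shows "act k n \<chi> x = act k n \<phi> x"
  using act_comp[OF monotone_map_id assms(1,2), of \<chi>] act_id[OF act_closed[OF assms(1,2)]] assms(3)
  by simp

lemma div_eq_one_imp_eq:
  "\<lbrakk>x \<in> carrier (G n); y \<in> carrier (G n); x \<otimes>\<^bsub>G n\<^esub> inv\<^bsub>G n\<^esub> y = \<one>\<^bsub>G n\<^esub>\<rbrakk> \<Longrightarrow> x = y"
  using grp.right_cancel[of "inv\<^bsub>G n\<^esub> y" n x y] by simp

lemma mult_div_cancel:
  "\<lbrakk>x \<in> carrier (G n); y \<in> carrier (G n)\<rbrakk> \<Longrightarrow> x \<otimes>\<^bsub>G n\<^esub> (y \<otimes>\<^bsub>G n\<^esub> inv\<^bsub>G n\<^esub> x) = y"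
  using grp.m_lcomm[of x n y "inv\<^bsub>G n\<^esub> x"] by simp

text \<open>A simplex that misses the vertex \<open>j\<close> factors through the \<open>j\<close>-th face.\<close>

lemma act_eq_one_if_misses:
  assumes "monotone_map k n \<tau>" "\<And>i. i \<le> k \<Longrightarrow> \<tau> i \<noteq> j" "j \<le> n" "n \<ge> 1"
    and "x \<in> carrier (G n)" "act (n - 1) n (skip j) x = \<one>\<^bsub>G (n - 1)\<^esub>"
  shows "act k n \<tau> x = \<one>\<^bsub>G k\<^esub>"
proof -
  have m: "monotone_map k (n - 1) (\<lambda>i. merge j (\<tau> i))"
    using assms by (intro monotone_map_merge_comp)
  have "act k n \<tau> x = act k (n - 1) (\<lambda>i. merge j (\<tau> i)) (act (n - 1) n (skip j) x)"
    using act_comp[OF m monotone_map_skip[OF assms(4)] assms(5)] assms(2) skip_merge by metis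
  then show ?thesis using assms(6) act_one[OF m] by simp
qed

text \<open>Let \<open>x\<close> be killed by all faces but the \<open>(r+1)\<close>-st. Subtracting the degeneracy \<open>s\<^sub>r d\<^bsub>r+1\<^esub> x\<close>
  kills that face as well, at the price of the face \<open>d\<^sub>r\<close>, which becomes \<open>-d\<^bsub>r+1\<^esub> x\<close>.\<close>

lemma cycles_Suc:
  assumes r: "Suc r \<le> n" and trivial: "cycles r n \<subseteq> {\<one>\<^bsub>G n\<^esub>}"
  shows "cycles (Suc r) n \<subseteq> {\<one>\<^bsub>G n\<^esub>}"
proof
  fix x assume "x \<in> cycles (Suc r) n"
  then have x: "x \<in> carrier (G n)"
    and faces: "\<And>j. j \<le> n \<Longrightarrow> j \<noteq> Suc r \<Longrightarrow> act (n - 1) n (skip j) x = \<one>\<^bsub>G (n - 1)\<^esub>"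
    by (auto simp: cycles_def)
  have n: "n \<ge> 1" "Suc (n - 1) = n" using r by auto
  have d: "monotone_map (n - 1) n (skip j)" for j using monotone_map_skip n(1) .
  have s: "monotone_map n (n - 1) (merge r)" using monotone_map_merge[of r "n - 1"] n r by simp
  define w where "w = act (n - 1) n (skip (Suc r)) x"
  have w: "w \<in> carrier (G (n - 1))" using w_def act_closed[OF d x] by simp
  have sw: "act n (n - 1) (merge r) w \<in> carrier (G n)" using act_closed[OF s w] .
  define y where "y = x \<otimes>\<^bsub>G n\<^esub> inv\<^bsub>G n\<^esub> act n (n - 1) (merge r) w"
  have y: "y \<in> carrier (G n)" using x sw by (simp add: y_def)
  have dy: "act (n - 1) n (skip j) y
      = act (n - 1) n (skip j) x \<otimes>\<^bsub>G (n - 1)\<^esub> inv\<^bsub>G (n - 1)\<^esub> act (n - 1) n (skip j) (act n (n - 1) (merge r) w)" for j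
    unfolding y_def using act_div[OF d x sw] .
  have dsw: "act (n - 1) n (skip j) (act n (n - 1) (merge r) w) = w" if "j = r \<or> j = Suc r" for j
  proof -
    have "act (n - 1) n (skip j) (act n (n - 1) (merge r) w) = act (n - 1) (n - 1) (\<lambda>i. i) w"
      using that by (intro act_comp[OF d s w]) (auto simp: skip_def merge_def)
    then show ?thesis using act_id[OF w] by simp
  qed
  have other: "act (n - 1) n (skip j) (act n (n - 1) (merge r) w) = \<one>\<^bsub>G (n - 1)\<^esub>"
    if j: "j \<le> n" "j \<noteq> r" "j \<noteq> Suc r" for j
  proof -
    have "act n (n - 1) (merge r) w = act n n (\<lambda>i. skip (Suc r) (merge r i)) x"
      unfolding w_def by (rule act_comp[OF s d x]) simp
    moreover have m: "monotone_map n n (\<lambda>i. skip (Suc r) (merge r i))"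
      using monotone_map_comp[OF s d] .
    ultimately have eq: "act (n - 1) n (skip j) (act n (n - 1) (merge r) w)
        = act (n - 1) n (\<lambda>i. skip (Suc r) (merge r (skip j i))) x"
      using act_comp[OF d m x, of "\<lambda>i. skip (Suc r) (merge r (skip j i))"] by simp
    show ?thesis unfolding eq
    proof (rule act_eq_one_if_misses[where j = j])
      show "monotone_map (n - 1) n (\<lambda>i. skip (Suc r) (merge r (skip j i)))"
        using monotone_map_comp[OF d m] .
      show "skip (Suc r) (merge r (skip j i)) \<noteq> j" for i
        using j by (auto simp: skip_def merge_def split: if_splits)
      show "act (n - 1) n (skip j) x = \<one>\<^bsub>G (n - 1)\<^esub>" using faces j by simp
    qed (use j n x in simp_all)
  qed
  have "y \<in> cycles r n"
    unfolding cycles_def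
  proof (intro CollectI conjI allI impI y)
    fix j assume j: "j \<le> n" "j \<noteq> r"
    show "act (n - 1) n (skip j) y = \<one>\<^bsub>G (n - 1)\<^esub>"
    proof (cases "j = Suc r")
      case True
      then show ?thesis using dy[of j] dsw[of j] w w_def by simp
    next
      case False
      then show ?thesis using dy[of j] other[of j] faces[of j] j by simp
    qed
  qed
  then have "y = \<one>\<^bsub>G n\<^esub>" using trivial by blast
  then have "\<one>\<^bsub>G (n - 1)\<^esub> = inv\<^bsub>G (n - 1)\<^esub> w"
    using dy[of r] dsw[of r] faces[of r] act_one[OF d] r w by simp
  then have "w = \<one>\<^bsub>G (n - 1)\<^esub>" using w by (metis grp.inv_inv grp.inv_one)
  then have "x \<in> cycles r n" using x faces w_def by (auto simp: cycles_def)
  then show "x \<in> {\<one>\<^bsub>G n\<^esub>}" using trivial by blast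
qed

text \<open>For \<open>r = n\<close>: the Moore complex defined by the faces \<open>d\<^sub>0, \<dots>, d\<^bsub>n-1\<^esub>\<close> vanishes in a
  degree where the one defined by \<open>d\<^sub>1, \<dots>, d\<^sub>n\<close> does. Hence truncation is invariant under reversal.\<close>

lemma cycles_trivial_all:
  assumes "cycles 0 n \<subseteq> {\<one>\<^bsub>G n\<^esub>}" "r \<le> n"
  shows "cycles r n \<subseteq> {\<one>\<^bsub>G n\<^esub>}"
  using assms(2)
proof (induction r)
  case (Suc r)
  then show ?case by (intro cycles_Suc) simp_all
qed (use assms(1) in simp)

section \<open>Descent for cones\<close>

text \<open>The chains of the standard simplex relative to a cone split into contractible pieces, one for each
  pair \<open>(U, {0} \<union> U)\<close> with \<open>U\<close> outside the base of the cone, so a family on a cone always extends. The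
  extension is built greedily: the values on the faces \<open>{0} \<union> U\<close> of the cone are corrected one after
  the other, in the order of \<open>\<Sum>U\<close>, by adding the pullback \<open>W\<close> of the error along the retraction
  \<open>round_down U\<close>. By the choice of the order, a face \<open>{0} \<union> V\<close> that was treated earlier is not mapped
  onto \<open>{0} \<union> U\<close>; its image lies in a smaller face \<open>{0} \<union> (U - {u})\<close>, on which the error is already
  zero, and so the correction leaves it unchanged.\<close>

lemma cone_extends:
  assumes F: "\<F> \<subseteq> Pow {0..n}" and apex: "\<And>f. f \<in> \<F> \<Longrightarrow> 0 \<in> f" and c: "matching n \<F> c"
  shows "\<exists>x \<in> carrier (G n). \<forall>k \<sigma>. simplex_over n \<F> k \<sigma> \<longrightarrow> act k n \<sigma> x = c k \<sigma>"
proof -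
  \<comment> \<open>The base of the cone; each member \<open>U\<close> stands for the face \<open>{0} \<union> U\<close>.\<close>
  define L where "L = {U. U \<subseteq> {1..n} \<and> (\<exists>f \<in> \<F>. U \<subseteq> f)}"
  define C where "C U = c n (round_down U)" for U
  note r = monotone_map_round_down[of n]
  have finL: "finite L" unfolding L_def by simp
  have over: "simplex_over n \<F> n (round_down U)" if "U \<in> L" for U
  proof -
    obtain f where "f \<in> \<F>" "U \<subseteq> f" using \<open>U \<in> L\<close> by (auto simp: L_def)
    then have "round_down U ` {0..n} \<subseteq> f" using round_down_in[of U] apex[of f] by (intro image_subsetI) (metis insert_iff subsetD)
    then show ?thesis using \<open>f \<in> \<F>\<close> r by (auto simp: simplex_over_def)
  qed
  have C: "C U \<in> carrier (G n)" if "U \<in> L" for U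
    unfolding C_def using c over[OF that] by (rule matching_closed)
  note c_comp = matching_comp[OF c]
  have fix_sub: "round_down U (round_down V i) = round_down V i" if "V \<subseteq> U" for U V i
    using round_down_in[of V i] that by (intro round_down_fixes) auto
  have C_sub: "act n n (round_down V) (C U) = C V" if "U \<in> L" "V \<in> L" "V \<subseteq> U" for U V
    unfolding C_def using that over r fix_sub by (intro c_comp) auto
  have extend: "\<exists>x \<in> carrier (G n). \<forall>U \<in> S. act n n (round_down U) x = C U"
    if "finite S" "S \<subseteq> L" "\<And>U V. U \<in> S \<Longrightarrow> V \<subseteq> U \<Longrightarrow> V \<in> S" for S
    using that
  proof (induction S rule: finite_ranking_induct[where f = "\<lambda>U. \<Sum>U"])
    case empty
    then show ?case using grp.one_closed by blast
  next
    case (insert U S)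
    show ?case
    proof (cases "U \<in> S")
      case True
      then have "insert U S = S" by blast
      then show ?thesis using insert by simp
    next
      case False
      have UL: "U \<in> L" "S \<subseteq> L" using insert.prems by auto
      have finU: "finite V" "0 \<notin> V" if "V \<in> L" for V
        using that finite_subset[of V "{1..n}"] by (auto simp: L_def)
      \<comment> \<open>A proper superset of \<open>U\<close> has a larger sum and cannot have been treated before \<open>U\<close>.\<close>
      have down: "V \<in> S" if "U' \<in> S" "V \<subseteq> U'" for U' V
      proof (rule ccontr)
        assume "V \<notin> S"
        then have "V = U" using insert.prems(2)[of U' V] that by auto
        then have "U \<subset> U'" using that \<open>U \<notin> S\<close> by auto
        then obtain v where v: "v \<in> U'" "v \<notin> U" by blast
        have "U' \<in> L" using that(1) UL(2) by (rule rev_subsetD)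
        note f = finU[OF this]
        have "\<Sum>U < \<Sum>U'"
          using v f \<open>U \<subset> U'\<close> by (intro sum_strict_mono2[of _ _ v]) (auto intro: gr0I)
        then show False using insert.hyps(2)[OF that(1)] by simp
      qed
      have "\<exists>x \<in> carrier (G n). \<forall>V \<in> S. act n n (round_down V) x = C V"
        using UL(2) down by (rule insert.IH)
      then obtain x where x: "x \<in> carrier (G n)"
        and xS: "\<And>V. V \<in> S \<Longrightarrow> act n n (round_down V) x = C V"
        by blast
      define W where "W = C U \<otimes>\<^bsub>G n\<^esub> inv\<^bsub>G n\<^esub> act n n (round_down U) x"
      note eU = act_closed[OF r[of U] x]
      have W: "W \<in> carrier (G n)" using C[OF UL(1)] eU by (simp add: W_def)
      have W_sub: "act n n (round_down V) W = C V \<otimes>\<^bsub>G n\<^esub> inv\<^bsub>G n\<^esub> act n n (round_down V) x"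
        if "V \<in> L" "V \<subseteq> U" for V
      proof -
        have "act n n (round_down V) (act n n (round_down U) x) = act n n (round_down V) x"
          using fix_sub[OF that(2)] by (intro act_comp[OF r r x]) simp
        then show ?thesis
          unfolding W_def using act_div[OF r C[OF UL(1)] eU] C_sub[OF UL(1) that] by simp
      qed
      have WU: "act n n (round_down U) W = W" using W_sub[OF UL(1)] by (simp add: W_def)
      have W_vanishes: "act n n (round_down V) W = \<one>\<^bsub>G n\<^esub>" if V: "V \<in> S" for V
      proof -
        have VL: "V \<in> L" "V \<noteq> U" using V UL False by auto
        have "\<not> U \<subseteq> round_down U ` V"
          using round_down_onto_imp_eq[of V U, OF finU(1)[OF VL(1)] finU(2)[OF UL(1)] finU(2)[OF VL(1)]]
            insert.hyps(2)[OF V] VL(2) by metis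
        then obtain u where u: "u \<in> U" "u \<notin> round_down U ` V" by blast
        have uV: "u \<noteq> round_down U (round_down V i)" for i
        proof -
          have "u \<noteq> 0" using u(1) finU[OF UL(1)] by metis
          then show ?thesis
            using u(2) round_down_in[of V i] round_down_fixes[of 0 U] by auto
        qed
        let ?U' = "U - {u}"
        have U': "?U' \<in> S" using insert.prems(2)[of U ?U'] u(1) by auto
        have "act n n (round_down ?U') W = \<one>\<^bsub>G n\<^esub>"
        proof -
          have U'L: "?U' \<in> L" using U' UL(2) by blast
          then show ?thesis using W_sub[OF U'L] xS[OF U'] C[OF U'L] by simp
        qed
        moreover have "act n n (round_down V) W
            = act n n (\<lambda>i. round_down U (round_down V i)) (act n n (round_down ?U') W)"
        proof -
          have m: "monotone_map n n (\<lambda>i. round_down U (round_down V i))"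
            using monotone_map_comp[OF r r] .
          have "round_down ?U' (round_down U (round_down V i)) = round_down U (round_down V i)" for i
            using round_down_in[of U "round_down V i"] uV[of i] by (intro round_down_fixes) auto
          then have "act n n (\<lambda>i. round_down U (round_down V i)) (act n n (round_down ?U') W)
              = act n n (\<lambda>i. round_down U (round_down V i)) W"
            by (intro act_comp[OF m r W]) simp
          also have "\<dots> = act n n (round_down V) (act n n (round_down U) W)"
            by (rule act_comp[OF r r W, symmetric]) simp
          finally show ?thesis using WU by simp
        qed
        ultimately show ?thesis using act_one[OF monotone_map_comp[OF r r]] by simp
      qed
      have "act n n (round_down V) (x \<otimes>\<^bsub>G n\<^esub> W) = C V" if "V \<in> insert U S" for V
      proof (cases "V = U")
        case True
        have "act n n (round_down U) (x \<otimes>\<^bsub>G n\<^esub> W) = act n n (round_down U) x \<otimes>\<^bsub>G n\<^esub> W"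
          using act_mult[OF r x W] WU by simp
        also have "\<dots> = C U"
          unfolding W_def using mult_div_cancel[OF eU C[OF UL(1)]] .
        finally show ?thesis using True by simp
      next
        case False
        then have V: "V \<in> S" using that by simp
        then show ?thesis
          using act_mult[OF r x W] W_vanishes[OF V] xS[OF V] C[of V] UL(2) by auto
      qed
      then show ?thesis using x W by (intro bexI[of _ "x \<otimes>\<^bsub>G n\<^esub> W"]) auto
    qed
  qed
  have down: "V \<in> L" if "U \<in> L" "V \<subseteq> U" for U V
  proof -
    obtain f where "U \<subseteq> {1..n}" "f \<in> \<F>" "U \<subseteq> f" using \<open>U \<in> L\<close> by (auto simp: L_def)
    then have "V \<subseteq> {1..n}" "f \<in> \<F>" "V \<subseteq> f" using that(2) by simp_all
    then show ?thesis unfolding L_def by blast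
  qed
  have "\<exists>x \<in> carrier (G n). \<forall>U \<in> L. act n n (round_down U) x = C U"
    using finL subset_refl down by (rule extend)
  then obtain x where x: "x \<in> carrier (G n)"
    and xL: "\<And>U. U \<in> L \<Longrightarrow> act n n (round_down U) x = C U"
    by blast
  have "act k n \<sigma> x = c k \<sigma>" if \<sigma>: "simplex_over n \<F> k \<sigma>" for k \<sigma>
  proof -
    obtain f where f: "f \<in> \<F>" "\<sigma> ` {0..k} \<subseteq> f" and m: "monotone_map k n \<sigma>"
      using \<sigma> by (auto simp: simplex_over_def)
    let ?U = "f - {0}"
    have "f \<subseteq> {0..n}" using f(1) F by blast
    then have "?U \<subseteq> {1..n}" by (auto simp: Suc_le_eq)
    then have U: "?U \<in> L" using f(1) by (auto simp: L_def)
    have e: "\<forall>i\<le>k. \<sigma> i = round_down ?U (\<sigma> i)"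
    proof (intro allI impI)
      fix i assume "i \<le> k"
      then have "\<sigma> i \<in> f" using f(2) by (simp add: image_subset_iff)
      then have "\<sigma> i \<in> insert 0 ?U" by blast
      then show "\<sigma> i = round_down ?U (\<sigma> i)" by (rule round_down_fixes[symmetric])
    qed
    have "act k n \<sigma> x = act k n \<sigma> (act n n (round_down ?U) x)"
      using e by (intro act_comp[OF m r x, symmetric]) simp
    also have "\<dots> = c k \<sigma>"
      unfolding xL[OF U] C_def using c_comp[OF over[OF U] \<sigma> m e] .
    finally show ?thesis .
  qed
  then show ?thesis using x by blast
qed

text \<open>By hypothesis an element of degree above \<open>m\<close> is determined by its faces \<open>d\<^sub>1, \<dots>, d\<^sub>n\<close>, which are the faces through
  the vertex \<open>0\<close>. Descending, it is determined by the faces spanned by \<open>0\<close> and at most \<open>m\<close> further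
  vertices.\<close>

lemma eq_one_if_small_faces_eq_one:
  assumes trivial: "\<And>k. k > m \<Longrightarrow> cycles 0 k \<subseteq> {\<one>\<^bsub>G k\<^esub>}"
    and "x \<in> carrier (G n)"
    and "\<And>k \<sigma>. monotone_map k n \<sigma> \<Longrightarrow> card (\<sigma> ` {0..k} - {0}) \<le> m \<Longrightarrow> act k n \<sigma> x = \<one>\<^bsub>G k\<^esub>"
  shows "x = \<one>\<^bsub>G n\<^esub>"
  using assms(2,3)
proof (induction n arbitrary: x rule: less_induct)
  case (less n)
  show ?case
  proof (cases "n \<le> m")
    case True
    have "{0..n} - {0} = {1..n}" by auto
    then have "act n n (\<lambda>i. i) x = \<one>\<^bsub>G n\<^esub>" using True by (intro less.prems(2) monotone_map_id) simp
    then show ?thesis using act_id[OF less.prems(1)] by simp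
  next
    case False
    then have n: "n \<ge> 1" "n > m" "n - 1 < n" by auto
    have "act (n - 1) n (skip j) x = \<one>\<^bsub>G (n - 1)\<^esub>" if j: "j \<noteq> 0" for j
    proof (rule less.IH[OF n(3)])
      note d = monotone_map_skip[OF n(1), of j]
      show "act (n - 1) n (skip j) x \<in> carrier (G (n - 1))" using act_closed[OF d less.prems(1)] .
      fix k \<sigma> assume \<sigma>: "monotone_map k (n - 1) \<sigma>" and small: "card (\<sigma> ` {0..k} - {0}) \<le> m"
      have "(\<lambda>i. skip j (\<sigma> i)) ` {0..k} - {0} \<subseteq> skip j ` (\<sigma> ` {0..k} - {0})"
        using j by (auto simp: skip_def)
      then have "card ((\<lambda>i. skip j (\<sigma> i)) ` {0..k} - {0}) \<le> card (skip j ` (\<sigma> ` {0..k} - {0}))"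
        by (intro card_mono) auto
      also have "\<dots> \<le> card (\<sigma> ` {0..k} - {0})" by (intro card_image_le) auto
      finally have "act k n (\<lambda>i. skip j (\<sigma> i)) x = \<one>\<^bsub>G k\<^esub>"
        using small by (intro less.prems(2) monotone_map_comp[OF \<sigma> d]) simp
      then show "act k (n - 1) \<sigma> (act (n - 1) n (skip j) x) = \<one>\<^bsub>G k\<^esub>"
        using act_comp[OF \<sigma> d less.prems(1)] by metis
    qed
    then have "x \<in> cycles 0 n" using less.prems(1) by (auto simp: cycles_def)
    then show ?thesis using trivial[OF n(2)] by blast
  qed
qed

text \<open>The criterion behind all instances of descent below: extensions exist because \<open>\<F>\<close> is a cone, and
  they are unique because the cone contains all the small faces that determine an element.\<close>

theorem cone_glues:
  assumes trivial: "\<And>k. k > m \<Longrightarrow> cycles 0 k \<subseteq> {\<one>\<^bsub>G k\<^esub>}"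
    and F: "\<F> \<subseteq> Pow {0..n}" and apex: "\<And>f. f \<in> \<F> \<Longrightarrow> 0 \<in> f"
    and neighbourly: "\<And>U. U \<subseteq> {1..n} \<Longrightarrow> card U \<le> m \<Longrightarrow> \<exists>f \<in> \<F>. U \<subseteq> f"
  shows "glues n \<F>"
  unfolding glues_def
proof (intro allI impI ex_ex1I)
  fix c assume "matching n \<F> c"
  then show "\<exists>x. x \<in> carrier (G n) \<and> (\<forall>k \<sigma>. simplex_over n \<F> k \<sigma> \<longrightarrow> act k n \<sigma> x = c k \<sigma>)"
    using cone_extends[OF F apex] by blast
next
  fix c x y
  assume "x \<in> carrier (G n) \<and> (\<forall>k \<sigma>. simplex_over n \<F> k \<sigma> \<longrightarrow> act k n \<sigma> x = c k \<sigma>)"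
    and "y \<in> carrier (G n) \<and> (\<forall>k \<sigma>. simplex_over n \<F> k \<sigma> \<longrightarrow> act k n \<sigma> y = c k \<sigma>)"
  then have xy: "x \<in> carrier (G n)" "y \<in> carrier (G n)"
    and eq: "\<And>k \<sigma>. simplex_over n \<F> k \<sigma> \<Longrightarrow> act k n \<sigma> x = act k n \<sigma> y" by auto
  have "x \<otimes>\<^bsub>G n\<^esub> inv\<^bsub>G n\<^esub> y = \<one>\<^bsub>G n\<^esub>"
  proof (rule eq_one_if_small_faces_eq_one[OF trivial])
    show "x \<otimes>\<^bsub>G n\<^esub> inv\<^bsub>G n\<^esub> y \<in> carrier (G n)" using xy by simp
    fix k \<sigma> assume \<sigma>: "monotone_map k n \<sigma>" and small: "card (\<sigma> ` {0..k} - {0}) \<le> m"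
    have "\<sigma> i \<le> n" if "i \<le> k" for i using \<sigma> that by (simp add: monotone_map_def)
    then have "\<sigma> ` {0..k} - {0} \<subseteq> {1..n}" by (auto simp: Suc_le_eq)
    from neighbourly[OF this small] obtain f where "f \<in> \<F>" "\<sigma> ` {0..k} - {0} \<subseteq> f" by blast
    then have "\<sigma> ` {0..k} \<subseteq> f" using apex[of f] by (simp add: Diff_subset_conv insert_absorb)
    then have "simplex_over n \<F> k \<sigma>" using \<sigma> \<open>f \<in> \<F>\<close> by (auto simp: simplex_over_def)
    then show "act k n \<sigma> (x \<otimes>\<^bsub>G n\<^esub> inv\<^bsub>G n\<^esub> y) = \<one>\<^bsub>G k\<^esub>"
      using act_div[OF \<sigma> xy] eq act_closed[OF \<sigma> xy(2)] by simp
  qed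
  then show "x = y" using div_eq_one_imp_eq xy by blast
qed

lemma glues_imp_eq_one:
  assumes "glues n \<F>" and x: "x \<in> carrier (G n)"
    and vanish: "\<And>k \<sigma>. simplex_over n \<F> k \<sigma> \<Longrightarrow> act k n \<sigma> x = \<one>\<^bsub>G k\<^esub>"
  shows "x = \<one>\<^bsub>G n\<^esub>"
proof -
  let ?P = "\<lambda>y. y \<in> carrier (G n) \<and> (\<forall>k \<sigma>. simplex_over n \<F> k \<sigma> \<longrightarrow> act k n \<sigma> y = \<one>\<^bsub>G k\<^esub>)"
  have "matching n \<F> (\<lambda>k \<sigma>. \<one>\<^bsub>G k\<^esub>)" by (auto simp: matching_def act_one)
  with assms(1)[unfolded glues_def, rule_format] have "\<exists>!y. ?P y" .
  moreover have "?P \<one>\<^bsub>G n\<^esub>" by (auto simp: simplex_over_def act_one)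
  moreover have "?P x" using x vanish by simp
  ultimately show ?thesis by (metis (no_types, lifting))
qed

end

section \<open>Reversal and cones at the last vertex\<close>

definition reflect :: "nat \<Rightarrow> nat set \<Rightarrow> nat set" where
  "reflect n I = (\<lambda>i. n - i) ` I"

lemma mem_reflect: "I \<subseteq> {0..n} \<Longrightarrow> i \<in> reflect n I \<longleftrightarrow> i \<le> n \<and> n - i \<in> I"
  by (force simp: reflect_def image_iff)

lemma reflect_subset: "reflect n I \<subseteq> {0..n}"
  by (auto simp: reflect_def)

lemma reflect_reflect: "I \<subseteq> {0..n} \<Longrightarrow> reflect n (reflect n I) = I"
  by (auto simp: set_eq_iff mem_reflect reflect_subset)

context simplicial_abelian_group
begin

interpretation grp: comm_group "G n" for n by (rule comm_group)

definition opposite_act :: "nat \<Rightarrow> nat \<Rightarrow> (nat \<Rightarrow> nat) \<Rightarrow> 'g \<Rightarrow> 'g" where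
  "opposite_act k n \<phi> = act k n (reverse_map k n \<phi>)"

text \<open>Reversal turns a simplicial group into another one on the same groups, so every result on cones with
  apex \<open>0\<close> has a mirror image for the apex \<open>n\<close>.\<close>

lemma opposite: "simplicial_abelian_group G opposite_act"
proof (rule simplicial_abelian_group.intro)
  show "comm_group (G n)" for n by (rule comm_group)
next
  fix k n \<phi> assume "monotone_map k n \<phi>"
  then show "opposite_act k n \<phi> \<in> hom (G n) (G k)"
    unfolding opposite_act_def by (intro act_hom monotone_map_reverse)
next
  fix x n assume x: "x \<in> carrier (G n)"
  have "act n n (reverse_map n n (\<lambda>i. i)) x = act n n (\<lambda>i. i) x"
    by (intro act_cong monotone_map_id x) (simp add: reverse_map_def)
  then show "opposite_act n n (\<lambda>i. i) x = x" using act_id[OF x] by (simp add: opposite_act_def)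
next
  fix k l n :: nat and \<phi> \<psi> \<chi> :: "nat \<Rightarrow> nat" and x
  assume \<phi>: "monotone_map k l \<phi>" and \<psi>: "monotone_map l n \<psi>" and x: "x \<in> carrier (G n)"
    and eq: "\<And>i. i \<le> k \<Longrightarrow> \<chi> i = \<psi> (\<phi> i)"
  show "opposite_act k l \<phi> (opposite_act l n \<psi> x) = opposite_act k n \<chi> x"
    unfolding opposite_act_def
  proof (intro act_comp monotone_map_reverse \<phi> \<psi> x)
    fix i assume "i \<le> k"
    have "\<phi> (k - i) \<le> l" using \<phi> by (simp add: monotone_map_def)
    then show "reverse_map k n \<chi> i = reverse_map l n \<psi> (reverse_map k l \<phi> i)"
      using eq[of "k - i"] by (simp add: reverse_map_def)
  qed
qed

lemma simplex_over_reverse: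
  assumes "simplex_over n (reflect n ` \<F>) k \<sigma>" "\<F> \<subseteq> Pow {0..n}"
  shows "simplex_over n \<F> k (reverse_map k n \<sigma>)"
proof -
  obtain f where f: "f \<in> \<F>" "\<sigma> ` {0..k} \<subseteq> reflect n f" and \<sigma>: "monotone_map k n \<sigma>"
    using assms(1) by (auto simp: simplex_over_def)
  have sub: "f \<subseteq> {0..n}" using f(1) assms(2) by auto
  have "reverse_map k n \<sigma> i \<in> f" for i
  proof -
    have "\<sigma> (k - i) \<in> reflect n f" using f(2) by (simp add: image_subset_iff)
    then show ?thesis using mem_reflect[OF sub] by (simp add: reverse_map_def)
  qed
  then show ?thesis using f(1) monotone_map_reverse[OF \<sigma>] by (auto simp: simplex_over_def)
qed

lemma simplex_over_reverse':
  assumes "simplex_over n \<F> k \<sigma>"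
  shows "simplex_over n (reflect n ` \<F>) k (reverse_map k n \<sigma>)"
proof -
  obtain f where f: "f \<in> \<F>" "\<sigma> ` {0..k} \<subseteq> f" and \<sigma>: "monotone_map k n \<sigma>"
    using assms(1) by (auto simp: simplex_over_def)
  have "reverse_map k n \<sigma> i \<in> reflect n f" for i
    using f(2) by (auto simp: reverse_map_def reflect_def image_subset_iff)
  then show ?thesis using f(1) monotone_map_reverse[OF \<sigma>] by (auto simp: simplex_over_def)
qed

text \<open>Transport of descent along reversal: a family on the reflected cover becomes, after reversing all its
  simplices, a family on \<open>\<F>\<close> for the opposite simplicial group.\<close>

lemma glues_reflect:
  assumes glues: "simplicial_abelian_group.glues G opposite_act n \<F>" and F: "\<F> \<subseteq> Pow {0..n}"
  shows "glues n (reflect n ` \<F>)"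
proof -
  interpret opp: simplicial_abelian_group G opposite_act by (rule opposite)
  show ?thesis
    unfolding glues_def
  proof (intro allI impI)
    fix c assume c: "matching n (reflect n ` \<F>) c"
    note c_closed = matching_closed[OF c] and c_comp = matching_comp[OF c]
    define c' where "c' k \<sigma> = c k (reverse_map k n \<sigma>)" for k \<sigma>
    have "opp.matching n \<F> c'"
      unfolding opp.matching_def
    proof (intro conjI allI impI)
      show "c' k \<sigma> \<in> carrier (G k)" if "simplex_over n \<F> k \<sigma>" for k \<sigma>
        unfolding c'_def using simplex_over_reverse'[OF that] by (rule c_closed)
    next
      fix k l \<alpha> \<tau> \<sigma>
      assume \<tau>: "simplex_over n \<F> l \<tau>" and \<sigma>: "simplex_over n \<F> k \<sigma>"
        and \<alpha>: "monotone_map k l \<alpha>" and eq: "\<forall>i\<le>k. \<sigma> i = \<tau> (\<alpha> i)"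
      have "reverse_map k n \<sigma> i = reverse_map l n \<tau> (reverse_map k l \<alpha> i)" if "i \<le> k" for i
      proof -
        have "\<alpha> (k - i) \<le> l" using \<alpha> by (simp add: monotone_map_def)
        then show ?thesis using eq by (simp add: reverse_map_def)
      qed
      then show "opposite_act k l \<alpha> (c' l \<tau>) = c' k \<sigma>"
        unfolding opposite_act_def c'_def
        by (intro c_comp simplex_over_reverse' monotone_map_reverse \<tau> \<sigma> \<alpha>) simp
    qed
    then have ex: "\<exists>!x. x \<in> carrier (G n) \<and> (\<forall>k \<sigma>. simplex_over n \<F> k \<sigma> \<longrightarrow> opposite_act k n \<sigma> x = c' k \<sigma>)"
      using glues unfolding opp.glues_def by simp
    have "(\<forall>k \<sigma>. simplex_over n \<F> k \<sigma> \<longrightarrow> opposite_act k n \<sigma> x = c' k \<sigma>) \<longleftrightarrow>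
        (\<forall>k \<sigma>. simplex_over n (reflect n ` \<F>) k \<sigma> \<longrightarrow> act k n \<sigma> x = c k \<sigma>)" (is "?L \<longleftrightarrow> ?R")
      if x: "x \<in> carrier (G n)" for x
    proof
      assume L: ?L
      show ?R
      proof (intro allI impI)
        fix k \<sigma> assume \<sigma>: "simplex_over n (reflect n ` \<F>) k \<sigma>"
        have m: "monotone_map k n \<sigma>" using \<sigma> by (simp add: simplex_over_def)
        have r: "simplex_over n \<F> k (reverse_map k n \<sigma>)" using \<sigma> F by (rule simplex_over_reverse)
        let ?rr = "reverse_map k n (reverse_map k n \<sigma>)"
        have "act k n ?rr x = c k ?rr"
          using L r by (simp add: opposite_act_def c'_def)
        moreover have "act k n ?rr x = act k n \<sigma> x"
          using m x by (rule act_cong) (rule reverse_reverse_map[OF m])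
        moreover have "c k ?rr = c k \<sigma>"
        proof -
          have "act k k (\<lambda>i. i) (c k ?rr) = c k \<sigma>"
            by (intro c_comp simplex_over_reverse' r \<sigma> monotone_map_id)
              (simp add: reverse_reverse_map[OF m])
          then show ?thesis using act_id[OF c_closed[OF simplex_over_reverse'[OF r]]] by simp
        qed
        ultimately show "act k n \<sigma> x = c k \<sigma>" by simp
      qed
    next
      assume ?R
      then show ?L
        using simplex_over_reverse' by (simp add: opposite_act_def c'_def)
    qed
    then show "\<exists>!x. x \<in> carrier (G n) \<and> (\<forall>k \<sigma>. simplex_over n (reflect n ` \<F>) k \<sigma> \<longrightarrow> act k n \<sigma> x = c k \<sigma>)"
      using ex by (simp cong: conj_cong)
  qed
qed

lemma cycles_opposite:
  assumes "n \<ge> 1"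
  shows "simplicial_abelian_group.cycles G opposite_act 0 n \<subseteq> cycles n n"
proof
  interpret opp: simplicial_abelian_group G opposite_act by (rule opposite)
  fix x assume x: "x \<in> opp.cycles 0 n"
  have xc: "x \<in> carrier (G n)" using x by (simp add: opp.cycles_def)
  have "act (n - 1) n (skip j) x = \<one>\<^bsub>G (n - 1)\<^esub>" if j: "j \<le> n" "j \<noteq> n" for j
  proof -
    have "opposite_act (n - 1) n (skip (n - j)) x = \<one>\<^bsub>G (n - 1)\<^esub>"
      using x j by (simp add: opp.cycles_def)
    moreover have "opposite_act (n - 1) n (skip (n - j)) x = act (n - 1) n (skip j) x"
      unfolding opposite_act_def
      using monotone_map_skip[OF assms] xc
    proof (rule act_cong)
      fix i assume "i \<le> n - 1"
      then show "reverse_map (n - 1) n (skip (n - j)) i = skip j i"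
        using assms j by (auto simp: reverse_map_def skip_def)
    qed
    ultimately show ?thesis by simp
  qed
  then show "x \<in> cycles n n" using xc by (auto simp: cycles_def)
qed

theorem cocone_glues:
  assumes trivial: "\<And>k. k > m \<Longrightarrow> cycles 0 k \<subseteq> {\<one>\<^bsub>G k\<^esub>}"
    and F: "\<F> \<subseteq> Pow {0..n}" and apex: "\<And>f. f \<in> \<F> \<Longrightarrow> 0 \<in> f"
    and neighbourly: "\<And>U. U \<subseteq> {1..n} \<Longrightarrow> card U \<le> m \<Longrightarrow> \<exists>f \<in> \<F>. U \<subseteq> f"
  shows "glues n (reflect n ` \<F>)"
proof -
  interpret opp: simplicial_abelian_group G opposite_act by (rule opposite)
  have "opp.cycles 0 k \<subseteq> {\<one>\<^bsub>G k\<^esub>}" if "k > m" for k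
    using cycles_opposite[of k] cycles_trivial_all[OF trivial[OF that], of k] that by auto
  then have "opp.glues n \<F>" using F apex neighbourly by (rule opp.cone_glues)
  then show ?thesis using F by (rule glues_reflect)
qed

section \<open>From descent back to truncation\<close>

lemma face_of_degeneracy_eq_one:
  assumes y: "y \<in> carrier (G n)" and n: "n \<ge> 1" and i: "i \<le> n" and j': "j' \<le> n"
    and j: "j < i \<and> j' = j \<or> j > i + 1 \<and> j' = j - 1"
    and d: "act (n - 1) n (skip j') y = \<one>\<^bsub>G (n - 1)\<^esub>"
  shows "act n (Suc n) (skip j) (act (Suc n) n (merge i) y) = \<one>\<^bsub>G n\<^esub>"
proof -
  note s = monotone_map_skip[of "Suc n" j, simplified] monotone_map_merge[OF i]
  have "act n (Suc n) (skip j) (act (Suc n) n (merge i) y) = act n n (\<lambda>a. merge i (skip j a)) y"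
    using s y by (rule act_comp) simp
  also have "\<dots> = \<one>\<^bsub>G n\<^esub>"
  proof (rule act_eq_one_if_misses[OF monotone_map_comp[OF s] _ j' n y d])
    show "merge i (skip j a) \<noteq> j'" for a
      using j by (auto simp: merge_def skip_def split: if_splits)
  qed
  finally show ?thesis .
qed

lemma face_of_degeneracy_id:
  assumes y: "y \<in> carrier (G n)" and i: "i \<le> n" and j: "j = i \<or> j = Suc i"
  shows "act n (Suc n) (skip j) (act (Suc n) n (merge i) y) = y"
proof -
  note s = monotone_map_skip[of "Suc n" j, simplified] monotone_map_merge[OF i]
  have "act n (Suc n) (skip j) (act (Suc n) n (merge i) y) = act n n (\<lambda>a. a) y"
    using s y by (rule act_comp) (use j in \<open>auto simp: merge_def skip_def\<close>)
  then show ?thesis using act_id[OF y] by simp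
qed

text \<open>The element is \<open>y = (s\<^bsub>2r-1\<^esub> - s\<^bsub>2r-2\<^esub>) \<dots> (s\<^sub>3 - s\<^sub>2) (s\<^sub>1 - s\<^sub>0) x\<close>. A factor \<open>s\<^bsub>2i+1\<^esub> - s\<^bsub>2i\<^esub>\<close> is killed by
  \<open>d\<^bsub>2i+1\<^esub>\<close>, the face on which the two degeneracies agree, and each of the remaining faces in question
  moves past the factor until it meets its own factor or reaches \<open>x\<close>. Nothing is lost, since \<open>d\<^bsub>2i+2\<^esub>\<close> is
  a left inverse of the factor on the elements killed by \<open>d\<^bsub>2i+1\<^esub>\<close>. For \<open>r = k - 1\<close> all odd faces in
  dimension \<open>2k - 1\<close> vanish, while \<open>x\<close> can be recovered.\<close>

lemma ex_element_killed_by_odd_faces: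
  assumes x: "x \<in> cycles 0 k" and r: "r < k"
  shows "\<exists>y \<in> carrier (G (k + r)).
    (\<forall>j\<le>k + r. odd j \<or> j > 2 * r \<longrightarrow> act (k + r - 1) (k + r) (skip j) y = \<one>\<^bsub>G (k + r - 1)\<^esub>) \<and>
    (y = \<one>\<^bsub>G (k + r)\<^esub> \<longrightarrow> x = \<one>\<^bsub>G k\<^esub>)"
  using r
proof (induction r)
  case 0
  have "act (k - 1) k (skip j) x = \<one>\<^bsub>G (k - 1)\<^esub>" if "j \<le> k" "odd j \<or> j > 0" for j
    using x that by (auto simp: cycles_def intro: Nat.gr0I)
  moreover have "x \<in> carrier (G k)" using x by (simp add: cycles_def)
  ultimately show ?case by (intro bexI[of _ x]) simp_all
next
  case (Suc r)
  define n where "n = k + r"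
  have n: "n \<ge> 1" "2 * r + 2 \<le> n" using Suc.prems by (auto simp: n_def)
  have "\<exists>y \<in> carrier (G n). (\<forall>j\<le>n. odd j \<or> j > 2 * r \<longrightarrow> act (n - 1) n (skip j) y = \<one>\<^bsub>G (n - 1)\<^esub>) \<and>
      (y = \<one>\<^bsub>G n\<^esub> \<longrightarrow> x = \<one>\<^bsub>G k\<^esub>)"
    using Suc.IH Suc.prems by (simp add: n_def)
  then obtain y where y: "y \<in> carrier (G n)"
    and dy: "\<And>j. j \<le> n \<Longrightarrow> odd j \<or> j > 2 * r \<Longrightarrow> act (n - 1) n (skip j) y = \<one>\<^bsub>G (n - 1)\<^esub>"
    and yx: "y = \<one>\<^bsub>G n\<^esub> \<Longrightarrow> x = \<one>\<^bsub>G k\<^esub>"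
    by metis
  let ?s = "\<lambda>i. act (Suc n) n (merge i) y"
  have i: "2 * r \<le> n" "2 * r + 1 \<le> n" using n by simp_all
  have s: "?s i \<in> carrier (G (Suc n))" if "i \<le> n" for i
    using act_closed[OF monotone_map_merge[OF that] y] .
  \<comment> \<open>The factor \<open>s\<^bsub>2r+1\<^esub> - s\<^bsub>2r\<^esub>\<close> applied to \<open>y\<close>, written multiplicatively.\<close>
  define z where "z = ?s (2 * r + 1) \<otimes>\<^bsub>G (Suc n)\<^esub> inv\<^bsub>G (Suc n)\<^esub> ?s (2 * r)"
  have z: "z \<in> carrier (G (Suc n))" unfolding z_def using s i by simp
  have m: "monotone_map n (Suc n) (skip j)" for j using monotone_map_skip[of "Suc n" j] by simp
  have dz: "act n (Suc n) (skip j) z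
      = act n (Suc n) (skip j) (?s (2 * r + 1)) \<otimes>\<^bsub>G n\<^esub> inv\<^bsub>G n\<^esub> act n (Suc n) (skip j) (?s (2 * r))" for j
    unfolding z_def using act_div[OF m s s] i by simp
  have "act n (Suc n) (skip j) z = \<one>\<^bsub>G n\<^esub>"
    if j: "j \<le> Suc n" "odd j \<or> j > 2 * Suc r" for j
  proof (cases "j = 2 * r + 1")
    case True
    then show ?thesis using dz[of j] face_of_degeneracy_id[OF y, of _ j] i y by simp
  next
    case False
    \<comment> \<open>The index of the face after it has moved past both degeneracies.\<close>
    define j' where "j' = (if j < 2 * r + 1 then j else j - 1)"
    have j2: "j < 2 * r \<or> j > 2 * r + 2" using False j(2) by presburger
    have "act n (Suc n) (skip j) (?s i) = \<one>\<^bsub>G n\<^esub>" if "i = 2 * r \<or> i = 2 * r + 1" for i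
    proof (rule face_of_degeneracy_eq_one[OF y n(1)])
      show "i \<le> n" using that n by auto
      show "j' \<le> n" using j n by (auto simp: j'_def)
      show "j < i \<and> j' = j \<or> j > i + 1 \<and> j' = j - 1" using j2 that by (auto simp: j'_def)
      show "act (n - 1) n (skip j') y = \<one>\<^bsub>G (n - 1)\<^esub>"
      proof (rule dy)
        show "j' \<le> n" using j n by (auto simp: j'_def)
        show "odd j' \<or> j' > 2 * r" using j j2 by (auto simp: j'_def)
      qed
    qed
    then show ?thesis using dz[of j] by simp
  qed
  moreover have "z = \<one>\<^bsub>G (Suc n)\<^esub> \<longrightarrow> x = \<one>\<^bsub>G k\<^esub>"
  proof
    assume "z = \<one>\<^bsub>G (Suc n)\<^esub>"
    then have "\<one>\<^bsub>G n\<^esub> = act n (Suc n) (skip (2 * r + 2)) z" using act_one[OF m] by simp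
    also have "\<dots> = y"
    proof -
      have "act n (Suc n) (skip (2 * r + 2)) (?s (2 * r + 1)) = y"
        using y i(2) by (rule face_of_degeneracy_id) simp
      moreover have "act n (Suc n) (skip (2 * r + 2)) (?s (2 * r)) = \<one>\<^bsub>G n\<^esub>"
        using y n(1) i(1) i(2) by (rule face_of_degeneracy_eq_one) (use dy i in simp_all)
      ultimately show ?thesis using dz y by simp
    qed
    finally show "x = \<one>\<^bsub>G k\<^esub>" using yx by simp
  qed
  ultimately show ?case
    using z by (intro bexI[of _ z]) (simp_all add: n_def)
qed

lemma glues_avoiding_odd_imp_cycles_trivial:
  assumes k: "k \<ge> 1" and glues: "glues (2 * k - 1) \<F>"
    and miss: "\<And>f. f \<in> \<F> \<Longrightarrow> \<exists>j \<le> 2 * k - 1. odd j \<and> j \<notin> f"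
  shows "cycles 0 k \<subseteq> {\<one>\<^bsub>G k\<^esub>}"
proof
  fix x assume x: "x \<in> cycles 0 k"
  define n where "n = 2 * k - 1"
  have n: "n \<ge> 1" "k + (k - 1) = n" using k by (auto simp: n_def)
  obtain y where y: "y \<in> carrier (G n)"
    and dy: "\<And>j. j \<le> n \<Longrightarrow> odd j \<Longrightarrow> act (n - 1) n (skip j) y = \<one>\<^bsub>G (n - 1)\<^esub>"
    and yx: "y = \<one>\<^bsub>G n\<^esub> \<Longrightarrow> x = \<one>\<^bsub>G k\<^esub>"
    using ex_element_killed_by_odd_faces[OF x, of "k - 1"] k unfolding n(2) by auto
  have "y = \<one>\<^bsub>G n\<^esub>"
  proof (rule glues_imp_eq_one[OF glues[folded n_def] y])
    fix l \<sigma> assume "simplex_over n \<F> l \<sigma>"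
    then obtain f where f: "f \<in> \<F>" "\<sigma> ` {0..l} \<subseteq> f" and \<sigma>: "monotone_map l n \<sigma>"
      by (auto simp: simplex_over_def)
    obtain j where j: "j \<le> n" "odd j" "j \<notin> f" using miss[OF f(1)] by (auto simp: n_def)
    then have "\<sigma> i \<noteq> j" if "i \<le> l" for i using f(2) that by (auto simp: image_subset_iff)
    then show "act l n \<sigma> y = \<one>\<^bsub>G l\<^esub>"
      by (rule act_eq_one_if_misses[OF \<sigma> _ j(1) n(1) y dy[OF j(1,2)]])
  qed
  then show "x \<in> {\<one>\<^bsub>G k\<^esub>}" using yx by simp
qed

lemma glues_horn_imp_cycles_trivial:
  assumes n: "n \<ge> 1" and glues: "glues n (horn n 0)"
  shows "cycles 0 n \<subseteq> {\<one>\<^bsub>G n\<^esub>}"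
proof
  fix x assume "x \<in> cycles 0 n"
  then have x: "x \<in> carrier (G n)"
    and dx: "\<And>j. j \<le> n \<Longrightarrow> j \<noteq> 0 \<Longrightarrow> act (n - 1) n (skip j) x = \<one>\<^bsub>G (n - 1)\<^esub>"
    by (auto simp: cycles_def)
  have "x = \<one>\<^bsub>G n\<^esub>"
  proof (rule glues_imp_eq_one[OF glues x])
    fix l \<sigma> assume "simplex_over n (horn n 0) l \<sigma>"
    then obtain j where j: "j \<le> n" "j \<noteq> 0" and f: "\<sigma> ` {0..l} \<subseteq> {0..n} - {j}"
      and \<sigma>: "monotone_map l n \<sigma>"
      by (auto simp: simplex_over_def horn_def)
    have "\<sigma> i \<noteq> j" if "i \<le> l" for i using f that by (auto simp: image_subset_iff)
    then show "act l n \<sigma> x = \<one>\<^bsub>G l\<^esub>"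
      by (rule act_eq_one_if_misses[OF \<sigma> _ j(1) n x dx[OF j]])
  qed
  then show "x \<in> {\<one>\<^bsub>G n\<^esub>}" by simp
qed

end

section \<open>Horns and Segal covers\<close>

lemma horn_eq_image: "horn n i = (\<lambda>j. {0..n} - {j}) ` ({0..n} - {i})"
proof -
  have "{j. j \<in> {0..n} \<and> j \<noteq> i} = {0..n} - {i}" by auto
  then show ?thesis by (simp only: horn_def setcompr_eq_image)
qed

lemma horn_last_eq_reflect: "horn n n = reflect n ` horn n 0"
proof -
  have r: "reflect n ({0..n} - {j}) = {0..n} - {n - j}" if "j \<le> n" for j
    using that by (auto simp: set_eq_iff mem_reflect)
  have "(\<lambda>j. {0..n} - {j}) ` ({0..n} - {n}) = reflect n ` (\<lambda>j. {0..n} - {j}) ` ({0..n} - {0})"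
  proof -
    have "{0..n} - {n} = (\<lambda>j. n - j) ` ({0..n} - {0})"
    proof (intro equalityI subsetI)
      fix j assume "j \<in> {0..n} - {n}"
      then have "j = n - (n - j)" "n - j \<in> {0..n} - {0}" by auto
      then show "j \<in> (\<lambda>j. n - j) ` ({0..n} - {0})" by (rule image_eqI)
    qed auto
    then show ?thesis by (simp add: image_image r)
  qed
  then show ?thesis by (simp add: horn_eq_image)
qed

text \<open>Since \<open>I\<close> has odd cardinality, a gap has an even number of elements of \<open>I\<close> before it if and only if it
  has an odd number after it.\<close>

lemma lower_reflect_iff_upper:
  assumes I: "I \<subseteq> {0..n}"
  shows "reflect n I \<in> lower_segal_cover (2 * m) n \<longleftrightarrow> I \<in> upper_segal_cover (2 * m) n"
proof -
  have "inj_on (\<lambda>i. n - i) {0..n}" by (intro inj_onI) simp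
  then have inj: "inj_on (\<lambda>i. n - i) J" if "J \<subseteq> {0..n}" for J
    using that by (rule inj_on_subset)
  have fin: "finite I" using I finite_subset by blast
  have card: "card (reflect n I) = card I"
    unfolding reflect_def using inj[OF I] by (rule card_image)
  have gap: "even (card {j \<in> reflect n I. j > i}) \<longleftrightarrow> odd (card {j \<in> I. j > n - i})"
    if i: "i \<le> n" "n - i \<notin> I" and c: "card I = 2 * m + 1" for i
  proof -
    have "{j \<in> reflect n I. j > i} = (\<lambda>i. n - i) ` {j \<in> I. j < n - i}"
      using i I by (auto simp: reflect_def)
    moreover have "{j \<in> I. j < n - i} \<subseteq> {0..n}" using I by auto
    ultimately have below: "card {j \<in> reflect n I. j > i} = card {j \<in> I. j < n - i}"
      using card_image[OF inj] by simp
    have split: "I = {j \<in> I. j < n - i} \<union> {j \<in> I. j > n - i}"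
    proof (intro equalityI subsetI)
      fix j assume "j \<in> I"
      then show "j \<in> {j \<in> I. j < n - i} \<union> {j \<in> I. j > n - i}"
        using i(2) by (cases j "n - i" rule: linorder_cases) simp_all
    qed auto
    have "card I = card {j \<in> I. j < n - i} + card {j \<in> I. j > n - i}"
      by (subst split, rule card_Un_disjoint) (use fin in auto)
    then show ?thesis using c below by presburger
  qed
  have "(\<forall>i \<in> {0..n} - reflect n I. even (card {j \<in> reflect n I. j > i})) \<longleftrightarrow>
      (\<forall>i \<in> {0..n} - I. odd (card {j \<in> I. j > i}))" (is "?L \<longleftrightarrow> ?R") if c: "card I = 2 * m + 1"
  proof
    assume L: ?L
    show ?R
    proof
      fix i assume i: "i \<in> {0..n} - I"
      then have "n - i \<in> {0..n} - reflect n I" using mem_reflect[OF I] by auto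
      then show "odd (card {j \<in> I. j > i})" using L gap[of "n - i"] i c by auto
    qed
  next
    assume R: ?R
    show ?L
    proof
      fix i assume i: "i \<in> {0..n} - reflect n I"
      then have "n - i \<in> {0..n} - I" using mem_reflect[OF I] by auto
      then show "even (card {j \<in> reflect n I. j > i})" using R gap[of i] i c by auto
    qed
  qed
  then show ?thesis
    using I reflect_subset[of n I] card
    by (auto simp: lower_segal_cover_def upper_segal_cover_def even_subset_def odd_subset_def
        even_gap_def odd_gap_def)
qed

lemma upper_eq_reflect_lower:
  "upper_segal_cover (2 * m) n = reflect n ` lower_segal_cover (2 * m) n"
proof (intro equalityI subsetI)
  fix I assume I: "I \<in> upper_segal_cover (2 * m) n"
  then have "I \<subseteq> {0..n}" by (simp add: upper_segal_cover_def odd_subset_def)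
  then show "I \<in> reflect n ` lower_segal_cover (2 * m) n"
    using I lower_reflect_iff_upper[of I n m] reflect_reflect[of I n] by force
next
  fix J assume "J \<in> reflect n ` lower_segal_cover (2 * m) n"
  then obtain I where I: "I \<in> lower_segal_cover (2 * m) n" "J = reflect n I" by blast
  then have "I \<subseteq> {0..n}" by (simp add: lower_segal_cover_def even_subset_def)
  then show "J \<in> upper_segal_cover (2 * m) n"
    using I lower_reflect_iff_upper[of J n m] reflect_reflect[of I n] reflect_subset[of n I] by simp
qed

text \<open>Otherwise \<open>0\<close> would be a gap with all \<open>2m + 1\<close> elements of \<open>I\<close> after it.\<close>

lemma zero_in_lower:
  assumes "I \<in> lower_segal_cover (2 * m) n"
  shows "0 \<in> I"
proof (rule ccontr)
  assume "0 \<notin> I"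
  then have "{j \<in> I. j > 0} = I" by (auto intro: gr0I)
  moreover have "even (card {j \<in> I. j > 0})"
    using assms \<open>0 \<notin> I\<close> by (simp add: lower_segal_cover_def even_subset_def even_gap_def)
  ultimately show False using assms by (simp add: lower_segal_cover_def)
qed

text \<open>The lower sets are \<open>{0}\<close> together with \<open>m\<close> disjoint pairs of neighbours in \<open>{1..n}\<close>. To cover \<open>U\<close>, drop
  the last vertex if it is not in \<open>U\<close>, and otherwise spend one pair on the last two vertices. This is the
  neighbourliness of cyclic polytopes.\<close>

lemma lower_neighbourly:
  assumes "U \<subseteq> {1..n}" "card U \<le> m" "2 * m \<le> n"
  shows "\<exists>I \<in> lower_segal_cover (2 * m) n. U \<subseteq> I"
  using assms
proof (induction n arbitrary: m U rule: less_induct)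
  case (less n)
  have finU: "finite U" using less.prems(1) finite_subset by blast
  consider "n = 2 * m" | "n > 2 * m" "n \<notin> U" | "n > 2 * m" "n \<in> U"
    using less.prems(3) by linarith
  then show ?case
  proof cases
    case 1
    have "{0..n} \<in> lower_segal_cover (2 * m) n"
      using 1 by (simp add: lower_segal_cover_def even_subset_def)
    moreover have "U \<subseteq> {0..n}" using less.prems(1) by auto
    ultimately show ?thesis by blast
  next
    case 2
    have "u \<in> {1..n - 1}" if "u \<in> U" for u
      using subsetD[OF less.prems(1) that] that 2(2) by (cases "u = n") auto
    then have "U \<subseteq> {1..n - 1}" by blast
    moreover have "n - 1 < n" "2 * m \<le> n - 1" using 2(1) by simp_all
    ultimately obtain I where I: "I \<in> lower_segal_cover (2 * m) (n - 1)" "U \<subseteq> I"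
      using less.IH[of "n - 1" U m] less.prems(2) by blast
    have sub: "I \<subseteq> {0..n - 1}" using I by (simp add: lower_segal_cover_def even_subset_def)
    then have last: "{j \<in> I. j > n} = {}" by auto
    have "even (card {j \<in> I. j > i})" if i: "i \<in> {0..n} - I" for i
    proof (cases "i = n")
      case True
      then show ?thesis using last by (metis card.empty even_zero)
    next
      case False
      then have "i \<in> {0..n - 1} - I" using i by auto
      then show ?thesis using I(1) by (simp add: lower_segal_cover_def even_subset_def even_gap_def)
    qed
    moreover have "I \<subseteq> {0..n}" using sub by auto
    ultimately have "I \<in> lower_segal_cover (2 * m) n"
      using I(1) by (simp add: lower_segal_cover_def even_subset_def even_gap_def)
    then show ?thesis using I(2) by blast
  next
    case 3
    let ?U = "U - {n, n - 1}"
    have "card ?U \<le> card (U - {n})" using finU by (intro card_mono) auto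
    also have "\<dots> = card U - 1" using 3(2) by simp
    finally have cardU: "card ?U \<le> m - 1" using less.prems(2) by simp
    have "card U \<ge> 1" using 3(2) finU by (auto simp: Suc_le_eq card_gt_0_iff)
    then have m: "m \<ge> 1" using less.prems(2) by simp
    have "u \<in> {1..n - 2}" if "u \<in> ?U" for u
      using subsetD[OF less.prems(1), of u] that by (cases "u = n"; cases "u = n - 1") auto
    then have "?U \<subseteq> {1..n - 2}" by blast
    moreover have "n - 2 < n" "2 * (m - 1) \<le> n - 2" using 3(1) m by simp_all
    ultimately obtain I where I: "I \<in> lower_segal_cover (2 * (m - 1)) (n - 2)" "?U \<subseteq> I"
      using less.IH[of "n - 2" ?U "m - 1"] cardU by blast
    have sub: "I \<subseteq> {0..n - 2}" using I by (simp add: lower_segal_cover_def even_subset_def)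
    then have finI: "finite I" using finite_subset by blast
    have notin: "n \<notin> I" "n - 1 \<notin> I" "n \<noteq> n - 1" using sub 3(1) m by auto
    let ?I = "insert n (insert (n - 1) I)"
    have "even (card {j \<in> ?I. j > i})" if i: "i \<in> {0..n} - ?I" for i
    proof -
      have i2: "i < n - 1" "i \<in> {0..n - 2} - I" using i by auto
      then have "{j \<in> ?I. j > i} = insert n (insert (n - 1) {j \<in> I. j > i})" by auto
      then have "card {j \<in> ?I. j > i} = Suc (Suc (card {j \<in> I. j > i}))"
        using notin finI by simp
      then show ?thesis
        using I(1) i2(2) by (simp add: lower_segal_cover_def even_subset_def even_gap_def)
    qed
    moreover have "?I \<subseteq> {0..n}" using sub by auto
    moreover have "card ?I = 2 * m + 1"
      using notin finI I(1) m by (simp add: lower_segal_cover_def)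
    ultimately have "?I \<in> lower_segal_cover (2 * m) n"
      by (simp add: lower_segal_cover_def even_subset_def even_gap_def)
    moreover have "U \<subseteq> ?I" using I(2) by auto
    ultimately show ?thesis by blast
  qed
qed

text \<open>Otherwise all gaps are even numbers. There is a gap because \<open>I\<close> has odd cardinality while \<open>[2k - 1]\<close>
  has \<open>2k\<close> elements. The vertices above the last gap \<open>g\<close> all belong to \<open>I\<close>, and there are
  \<open>2k - 1 - g\<close> of them, an odd number.\<close>

lemma lower_misses_odd:
  assumes I: "I \<in> lower_segal_cover (2 * m) (2 * k - 1)" and k: "k \<ge> 1"
  shows "\<exists>j \<le> 2 * k - 1. odd j \<and> j \<notin> I"
proof (rule ccontr)
  assume "\<not> ?thesis"
  then have odds: "j \<in> I" if "j \<le> 2 * k - 1" "odd j" for j using that by blast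
  have sub: "I \<subseteq> {0..2 * k - 1}" and card: "card I = 2 * m + 1"
    and gaps: "\<And>i. i \<in> {0..2 * k - 1} - I \<Longrightarrow> even (card {j \<in> I. j > i})"
    using I by (auto simp: lower_segal_cover_def even_subset_def even_gap_def)
  let ?gaps = "{0..2 * k - 1} - I"
  have "?gaps \<noteq> {}"
  proof
    assume "?gaps = {}"
    then have "I = {0..2 * k - 1}" using sub by auto
    then have "card I = 2 * k" using k by simp
    then show False using card by presburger
  qed
  moreover define g where "g = Max ?gaps"
  ultimately have g: "g \<in> ?gaps" and above: "\<And>i. i \<in> ?gaps \<Longrightarrow> i \<le> g"
    using Max_in[of ?gaps] Max_ge[of ?gaps] by auto
  have "even g" using g odds by auto
  have "{j \<in> I. j > g} = {g<..2 * k - 1}"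
  proof (intro equalityI subsetI)
    fix j assume "j \<in> {j \<in> I. j > g}"
    then show "j \<in> {g<..2 * k - 1}" using subsetD[OF sub, of j] by simp
  next
    fix j assume "j \<in> {g<..2 * k - 1}"
    then show "j \<in> {j \<in> I. j > g}" using above[of j] by force
  qed
  then have "card {j \<in> I. j > g} = 2 * k - 1 - g" by simp
  moreover have "g \<le> 2 * k - 1" using g by simp
  ultimately have "odd (card {j \<in> I. j > g})" using \<open>even g\<close> k by auto
  then show False using gaps[OF g] by simp
qed

context simplicial_abelian_group
begin

lemma glues_horns:
  assumes trivial: "\<And>k. k > m \<Longrightarrow> cycles 0 k \<subseteq> {\<one>\<^bsub>G k\<^esub>}" and n: "n > m"
  shows "glues n (horn n 0)" "glues n (horn n n)"
proof -
  have F: "horn n 0 \<subseteq> Pow {0..n}" by (auto simp: horn_def)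
  have apex: "0 \<in> f" if "f \<in> horn n 0" for f using that by (auto simp: horn_def)
  have neighbourly: "\<exists>f \<in> horn n 0. U \<subseteq> f" if U: "U \<subseteq> {1..n}" "card U \<le> m" for U
  proof -
    have "U \<noteq> {1..n}" using U(2) n by auto
    then obtain j where j: "j \<in> {1..n}" "j \<notin> U" using U(1) by blast
    then have "j \<in> {0..n} - {0}" by simp
    then have "{0..n} - {j} \<in> horn n 0" unfolding horn_eq_image by (rule imageI)
    moreover have "U \<subseteq> {0..n} - {j}" using U(1) j(2) by auto
    ultimately show ?thesis by blast
  qed
  show "glues n (horn n 0)" using trivial F apex neighbourly by (rule cone_glues)
  show "glues n (horn n n)"
    unfolding horn_last_eq_reflect using trivial F apex neighbourly by (rule cocone_glues)
qed

lemma glues_segal_covers: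
  assumes trivial: "\<And>k. k > m \<Longrightarrow> cycles 0 k \<subseteq> {\<one>\<^bsub>G k\<^esub>}" and n: "n \<ge> 2 * m"
  shows "glues n (lower_segal_cover (2 * m) n)" "glues n (upper_segal_cover (2 * m) n)"
proof -
  let ?F = "lower_segal_cover (2 * m) n"
  have F: "?F \<subseteq> Pow {0..n}" by (auto simp: lower_segal_cover_def even_subset_def)
  have nb: "\<exists>f \<in> ?F. U \<subseteq> f" if "U \<subseteq> {1..n}" "card U \<le> m" for U
    using that n by (rule lower_neighbourly)
  show "glues n ?F" using trivial F zero_in_lower nb by (rule cone_glues)
  show "glues n (upper_segal_cover (2 * m) n)"
    unfolding upper_eq_reflect_lower using trivial F zero_in_lower nb by (rule cocone_glues)
qed

end

section \<open>Transfer to an abelian category\<close>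

context simplicial_abelian_group
begin

lemma matching_cong:
  assumes "\<And>k \<sigma>. simplex_over n \<F> k \<sigma> \<Longrightarrow> c' k \<sigma> = c k \<sigma>" "matching n \<F> c"
  shows "matching n \<F> c'"
  using assms by (simp add: matching_def)

lemma matching_restrict:
  assumes c: "matching n \<F> c" and \<sigma>: "simplex_over n \<F> k \<sigma>"
  shows "c k (restrict \<sigma> {0..k}) = c k \<sigma>"
proof -
  have r: "simplex_over n \<F> k (restrict \<sigma> {0..k})"
    using \<sigma> by (simp add: simplex_over_def monotone_map_def)
  have "act k k (\<lambda>i. i) (c k \<sigma>) = c k (restrict \<sigma> {0..k})"
    using c \<sigma> r monotone_map_id by (rule matching_comp) simp
  then show ?thesis using act_id[OF matching_closed[OF c \<sigma>]] by simp
qed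

end

definition delta_map :: "nat \<Rightarrow> nat \<Rightarrow> (nat \<Rightarrow> nat) \<Rightarrow> delta_arr" where
  "delta_map k n \<phi> = (k, n, restrict \<phi> {0..k})"

lemma delta_map_homs: "monotone_map k n \<phi> \<Longrightarrow> delta_map k n \<phi> \<in> homs Delta k n"
  unfolding Delta_homs delta_map_def
  by (intro exI[of _ "restrict \<phi> {0..k}"]) (auto simp: monotone_map_def intro!: mono_onI)

lemma Delta_homsE:
  assumes "\<sigma> \<in> homs Delta k n"
  obtains \<phi> where "\<sigma> = delta_map k n \<phi>" "monotone_map k n \<phi>"
proof -
  obtain \<phi> where \<phi>: "\<sigma> = (k, n, \<phi>)" "\<phi> \<in> {0..k} \<rightarrow>\<^sub>E {0..n}" "mono_on {0..k} \<phi>"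
    using assms unfolding Delta_homs by blast
  have "restrict \<phi> {0..k} = \<phi>" using \<phi>(2) by (rule PiE_restrict)
  moreover have "monotone_map k n \<phi>"
    unfolding monotone_map_def
  proof (intro conjI allI impI)
    show "\<phi> i \<le> n" if "i \<le> k" for i using PiE_mem[OF \<phi>(2), of i] that by simp
    show "\<phi> i \<le> \<phi> j" if "i \<le> j" "j \<le> k" for i j using mono_onD[OF \<phi>(3), of i j] that by simp
  qed
  ultimately show thesis using that[of \<phi>] \<phi>(1) by (simp add: delta_map_def)
qed

lemma delta_map_id: "Ident Delta n = delta_map n n (\<lambda>i. i)"
  by (simp add: Delta_def delta_map_def)

lemma delta_map_comp:
  assumes "monotone_map k l \<phi>" "\<And>i. i \<le> k \<Longrightarrow> \<chi> i = \<psi> (\<phi> i)"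
  shows "delta_map l n \<psi> \<cdot>\<^bsub>Delta\<^esub> delta_map k l \<phi> = delta_map k n \<chi>"
  using assms by (auto simp: Delta_def delta_map_def compose_def monotone_map_def fun_eq_iff)

lemma delta_map_eq_iff: "delta_map k n \<phi> = delta_map k n \<psi> \<longleftrightarrow> (\<forall>i\<le>k. \<phi> i = \<psi> i)"
  by (auto simp: delta_map_def fun_eq_iff restrict_def)

lemma Dom_delta_map: "Dom Delta (delta_map k n \<phi>) = k"
  and Cod_delta_map: "Cod Delta (delta_map k n \<phi>) = n"
  by (simp_all add: delta_map_def Delta_def)

lemma delta_image_delta_map: "delta_image (delta_map k n \<phi>) = \<phi> ` {0..k}"
  by (simp add: delta_map_def)

lemma coface_eq_delta_map: "coface n j = delta_map (n - 1) n (skip j)"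
  by (simp add: coface_def delta_map_def skip_def fun_eq_iff restrict_def)

lemma delta_map_in_simplices:
  "simplex_over n \<F> k \<sigma> \<Longrightarrow> delta_map k n \<sigma> \<in> Obj (simplices_over n \<F>)"
  using delta_map_homs[of k n \<sigma>]
  by (auto simp: simplices_over_def Let_def simplex_over_def homs_def Cod_delta_map delta_image_delta_map)

lemma in_simplicesE:
  assumes "\<sigma> \<in> Obj (simplices_over n \<F>)"
  obtains k \<phi> where "\<sigma> = delta_map k n \<phi>" "simplex_over n \<F> k \<phi>"
proof -
  obtain f where f: "\<sigma> \<in> homs Delta (Dom Delta \<sigma>) n" "f \<in> \<F>" "delta_image \<sigma> \<subseteq> f"
    using assms by (auto simp: simplices_over_def Let_def homs_def)
  obtain \<phi> where \<phi>: "\<sigma> = delta_map (Dom Delta \<sigma>) n \<phi>" "monotone_map (Dom Delta \<sigma>) n \<phi>"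
    using Delta_homsE[OF f(1)] .
  have "delta_image \<sigma> = \<phi> ` {0..Dom Delta \<sigma>}" by (subst \<phi>(1)) (rule delta_image_delta_map)
  then have "simplex_over n \<F> (Dom Delta \<sigma>) \<phi>" using f \<phi>(2) by (auto simp: simplex_over_def)
  then show thesis using that \<phi>(1) by blast
qed

text \<open>The simplicial abelian group \<open>Hom(T, X)\<close> of generalised elements of \<open>X\<close>.\<close>

definition hom_sgroup :: "('o, 'm, 'x) ab_cat_scheme \<Rightarrow> ('o, 'm) sobj \<Rightarrow> 'o \<Rightarrow> nat \<Rightarrow> 'm monoid" where
  "hom_sgroup A X T n = hom_group A T (fobj X n)"

definition hom_act ::
  "('o, 'm, 'x) ab_cat_scheme \<Rightarrow> ('o, 'm) sobj \<Rightarrow> nat \<Rightarrow> nat \<Rightarrow> (nat \<Rightarrow> nat) \<Rightarrow> 'm \<Rightarrow> 'm" where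
  "hom_act A X k n \<phi> h = fmap X (delta_map k n \<phi>) \<cdot>\<^bsub>A\<^esub> h"

lemma carrier_hom_sgroup: "carrier (hom_sgroup A X T n) = homs A T (fobj X n)"
  and mult_hom_sgroup: "mult (hom_sgroup A X T n) = hom_add A"
  and one_hom_sgroup: "\<one>\<^bsub>hom_sgroup A X T n\<^esub> = hom_zero A T (fobj X n)"
  by (simp_all add: hom_sgroup_def hom_group_def)

abbreviation hom_matching where
  "hom_matching A X T \<equiv> simplicial_abelian_group.matching (hom_sgroup A X T) (hom_act A X)"

abbreviation hom_glues where
  "hom_glues A X T \<equiv> simplicial_abelian_group.glues (hom_sgroup A X T) (hom_act A X)"

abbreviation hom_cycles where
  "hom_cycles A X T \<equiv> simplicial_abelian_group.cycles (hom_sgroup A X T) (hom_act A X)"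

context
  fixes A :: "('o, 'm, 'x) ab_cat_scheme" (structure) and X :: "('o, 'm) sobj"
  assumes abelian: "abelian_category A" and simplicial: "simplicial_object A X"
begin

interpretation abelian_category A by (fact abelian)

lemma X_obj: "fobj X n \<in> Obj A"
  using abelian simplicial by (rule simplicial_object_obj)

lemma X_map: "f \<in> homs Delta k n \<Longrightarrow> fmap X f \<in> homs A (fobj X n) (fobj X k)"
  using simplicial by (auto simp: simplicial_object_def is_functor_def op_cat_def homs_def)

lemma X_comp:
  "f \<in> homs Delta a b \<Longrightarrow> g \<in> homs Delta b c \<Longrightarrow> fmap X (g \<cdot>\<^bsub>Delta\<^esub> f) = fmap X f \<cdot> fmap X g"
  using simplicial by (auto simp: simplicial_object_def is_functor_def op_cat_def homs_def)

lemma X_id: "fmap X (Ident Delta n) = Ident A (fobj X n)"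
  using simplicial by (auto simp: simplicial_object_def is_functor_def op_cat_def Delta_def)

lemma simplicial_hom:
  assumes T: "T \<in> Obj A"
  shows "simplicial_abelian_group (hom_sgroup A X T) (hom_act A X)"
proof (rule simplicial_abelian_group.intro)
  show "comm_group (hom_sgroup A X T n)" for n
    unfolding hom_sgroup_def using T X_obj by (rule hom_comm_group)
next
  fix k n \<phi> assume "monotone_map k n \<phi>"
  then have f: "fmap X (delta_map k n \<phi>) \<in> homs A (fobj X n) (fobj X k)"
    by (intro X_map delta_map_homs)
  show "hom_act A X k n \<phi> \<in> hom (hom_sgroup A X T n) (hom_sgroup A X T k)"
    using Comp_homs[OF f] Comp_add_right[OF f]
    by (auto simp: hom_def carrier_hom_sgroup mult_hom_sgroup hom_act_def)
next
  fix x n assume "x \<in> carrier (hom_sgroup A X T n)"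
  then show "hom_act A X n n (\<lambda>i. i) x = x"
    by (simp add: hom_act_def carrier_hom_sgroup delta_map_id[symmetric] X_id Ident_left)
next
  fix k l n \<phi> \<psi> \<chi> x
  assume \<phi>: "monotone_map k l \<phi>" and \<psi>: "monotone_map l n \<psi>"
    and x: "x \<in> carrier (hom_sgroup A X T n)" and eq: "\<And>i. i \<le> k \<Longrightarrow> \<chi> i = \<psi> (\<phi> i)"
  note f = delta_map_homs[OF \<phi>] and g = delta_map_homs[OF \<psi>]
  have "fmap X (delta_map k l \<phi>) \<cdot> (fmap X (delta_map l n \<psi>) \<cdot> x)
      = (fmap X (delta_map k l \<phi>) \<cdot> fmap X (delta_map l n \<psi>)) \<cdot> x"
    using Comp_assoc[OF X_map[OF f] X_map[OF g], of x T] x by (simp add: carrier_hom_sgroup)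
  also have "\<dots> = fmap X (delta_map k n \<chi>) \<cdot> x"
    using X_comp[OF f g] delta_map_comp[OF \<phi>, of \<chi> \<psi> n] eq by simp
  finally show "hom_act A X k l \<phi> (hom_act A X l n \<psi> x) = hom_act A X k n \<chi> x"
    by (simp add: hom_act_def)
qed

lemma is_cone_iff_matching:
  assumes T: "T \<in> Obj A"
  shows "is_cone A (op_cat (simplices_over n \<F>)) (comp_functor X simplices_forget) T q \<longleftrightarrow>
    hom_matching A X T n \<F> (\<lambda>k \<sigma>. q (delta_map k n \<sigma>))"
proof -
  interpret G: simplicial_abelian_group "hom_sgroup A X T" "hom_act A X"
    using T by (rule simplicial_hom)
  let ?S = "simplices_over n \<F>"
  have arr: "(\<sigma>, \<alpha>, \<tau>) \<in> Arr ?S \<longleftrightarrow> \<sigma> \<in> Obj ?S \<and> \<tau> \<in> Obj ?S \<and>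
      \<alpha> \<in> homs Delta (Dom Delta \<sigma>) (Dom Delta \<tau>) \<and> \<tau> \<cdot>\<^bsub>Delta\<^esub> \<alpha> = \<sigma>" for \<sigma> \<alpha> \<tau>
    by (simp add: simplices_over_def Let_def)
  have cone: "is_cone A (op_cat ?S) (comp_functor X simplices_forget) T q \<longleftrightarrow>
      (\<forall>\<sigma> \<in> Obj ?S. q \<sigma> \<in> homs A T (fobj X (Dom Delta \<sigma>))) \<and>
      (\<forall>\<sigma> \<alpha> \<tau>. (\<sigma>, \<alpha>, \<tau>) \<in> Arr ?S \<longrightarrow> fmap X \<alpha> \<cdot> q \<tau> = q \<sigma>)"
    using T by (auto simp: is_cone_def op_cat_def comp_functor_def simplices_forget_def
        simplices_over_def Let_def)
  show ?thesis
    unfolding cone G.matching_def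
  proof (intro iffI conjI allI impI ballI; elim conjE)
    fix k \<sigma> assume "\<forall>\<sigma> \<in> Obj ?S. q \<sigma> \<in> homs A T (fobj X (Dom Delta \<sigma>))" "simplex_over n \<F> k \<sigma>"
    then show "q (delta_map k n \<sigma>) \<in> carrier (hom_sgroup A X T k)"
      using delta_map_in_simplices[of n \<F> k \<sigma>] by (metis Dom_delta_map carrier_hom_sgroup)
  next
    fix k l \<alpha> \<tau> \<sigma>
    assume q: "\<forall>\<sigma> \<alpha> \<tau>. (\<sigma>, \<alpha>, \<tau>) \<in> Arr ?S \<longrightarrow> fmap X \<alpha> \<cdot> q \<tau> = q \<sigma>"
      and over: "simplex_over n \<F> l \<tau>" "simplex_over n \<F> k \<sigma>"
      and \<alpha>: "monotone_map k l \<alpha>" and eq: "\<forall>i\<le>k. \<sigma> i = \<tau> (\<alpha> i)"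
    have "(delta_map k n \<sigma>, delta_map k l \<alpha>, delta_map l n \<tau>) \<in> Arr ?S"
      unfolding arr using over delta_map_comp[OF \<alpha>, of \<sigma> \<tau> n] eq delta_map_homs[OF \<alpha>]
      by (simp add: delta_map_in_simplices Dom_delta_map)
    from q[rule_format, OF this]
    show "hom_act A X k l \<alpha> (q (delta_map l n \<tau>)) = q (delta_map k n \<sigma>)"
      by (simp add: hom_act_def)
  next
    fix \<sigma> assume q: "\<forall>k \<sigma>. simplex_over n \<F> k \<sigma> \<longrightarrow> q (delta_map k n \<sigma>) \<in> carrier (hom_sgroup A X T k)"
      and "\<sigma> \<in> Obj ?S"
    then obtain k \<phi> where "\<sigma> = delta_map k n \<phi>" "simplex_over n \<F> k \<phi>" using in_simplicesE by blast
    then show "q \<sigma> \<in> homs A T (fobj X (Dom Delta \<sigma>))"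
      using q by (simp add: Dom_delta_map carrier_hom_sgroup)
  next
    fix \<sigma> \<alpha> \<tau>
    assume q: "\<forall>k l \<alpha> \<tau> \<sigma>. simplex_over n \<F> l \<tau> \<longrightarrow> simplex_over n \<F> k \<sigma> \<longrightarrow> monotone_map k l \<alpha> \<longrightarrow>
          (\<forall>i\<le>k. \<sigma> i = \<tau> (\<alpha> i)) \<longrightarrow> hom_act A X k l \<alpha> (q (delta_map l n \<tau>)) = q (delta_map k n \<sigma>)"
      and "(\<sigma>, \<alpha>, \<tau>) \<in> Arr ?S"
    then have a: "\<sigma> \<in> Obj ?S" "\<tau> \<in> Obj ?S" "\<alpha> \<in> homs Delta (Dom Delta \<sigma>) (Dom Delta \<tau>)"
      "\<tau> \<cdot>\<^bsub>Delta\<^esub> \<alpha> = \<sigma>" unfolding arr by simp_all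
    obtain k \<phi> where \<sigma>: "\<sigma> = delta_map k n \<phi>" "simplex_over n \<F> k \<phi>" using in_simplicesE[OF a(1)] .
    obtain l \<psi> where \<tau>: "\<tau> = delta_map l n \<psi>" "simplex_over n \<F> l \<psi>" using in_simplicesE[OF a(2)] .
    obtain \<beta> where \<alpha>: "\<alpha> = delta_map k l \<beta>" "monotone_map k l \<beta>"
      using Delta_homsE[OF a(3)] by (auto simp: \<sigma>(1) \<tau>(1) Dom_delta_map)
    have "delta_map k n (\<lambda>i. \<psi> (\<beta> i)) = delta_map k n \<phi>"
      using a(4) delta_map_comp[OF \<alpha>(2), of "\<lambda>i. \<psi> (\<beta> i)" \<psi> n] by (simp add: \<sigma>(1) \<tau>(1) \<alpha>(1))
    then have "\<forall>i\<le>k. \<phi> i = \<psi> (\<beta> i)" unfolding delta_map_eq_iff by simp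
    then have "hom_act A X k l \<beta> (q (delta_map l n \<psi>)) = q (delta_map k n \<phi>)"
      using q \<sigma>(2) \<tau>(2) \<alpha>(2) by metis
    then show "fmap X \<alpha> \<cdot> q \<tau> = q \<sigma>" by (simp add: hom_act_def \<sigma>(1) \<tau>(1) \<alpha>(1))
  qed
qed

lemma restrict_eq_iff:
  "(\<forall>j \<in> Obj (op_cat (simplices_over n \<F>)). fmap X j \<cdot> u = q j) \<longleftrightarrow>
   (\<forall>k \<sigma>. simplex_over n \<F> k \<sigma> \<longrightarrow> hom_act A X k n \<sigma> u = q (delta_map k n \<sigma>))"
proof -
  have "Obj (op_cat (simplices_over n \<F>)) = Obj (simplices_over n \<F>)" by (simp add: op_cat_def)
  then show ?thesis
    unfolding hom_act_def by (metis delta_map_in_simplices in_simplicesE)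
qed

text \<open>By the Yoneda principle, a cone is a limit cone if and only if it is one on generalised elements.
  Descent provides an isomorphism \<open>u\<close> to some limit, and then the canonical cone itself is a limit.\<close>

lemma descent_iff_glues:
  "descent A X n \<F> \<longleftrightarrow> (\<forall>T \<in> Obj A. hom_glues A X T n \<F>)"
proof (intro iffI ballI)
  assume glues: "\<forall>T \<in> Obj A. hom_glues A X T n \<F>"
  have lim: "is_X_over A X n \<F> (fobj X n) (fmap X)"
    unfolding is_X_over_def is_limit_def
  proof (intro conjI allI impI is_X_over_canonical_cone simplicial)
    fix T q
    assume cone: "is_cone A (op_cat (simplices_over n \<F>)) (comp_functor X simplices_forget) T q"
    then have T: "T \<in> Obj A" by (simp add: is_cone_def)
    interpret G: simplicial_abelian_group "hom_sgroup A X T" "hom_act A X"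
      using T by (rule simplicial_hom)
    have "G.glues n \<F>" using glues T by simp
    moreover have "G.matching n \<F> (\<lambda>k \<sigma>. q (delta_map k n \<sigma>))"
      using cone is_cone_iff_matching[OF T] by simp
    ultimately show "\<exists>!u. u \<in> homs A T (fobj X n) \<and>
        (\<forall>j \<in> Obj (op_cat (simplices_over n \<F>)). fmap X j \<cdot> u = q j)"
      unfolding restrict_eq_iff G.glues_def carrier_hom_sgroup by simp
  qed
  let ?I = "Ident A (fobj X n)"
  have I: "?I \<in> homs A (fobj X n) (fobj X n)" using X_obj by (rule Ident_homs)
  have "fmap X \<sigma> \<cdot> ?I = fmap X \<sigma>" if "\<sigma> \<in> Obj (simplices_over n \<F>)" for \<sigma>
  proof -
    have "\<sigma> \<in> homs Delta (Dom Delta \<sigma>) n"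
      using that by (simp add: simplices_over_def Let_def homs_def)
    then show ?thesis using X_map Ident_right by blast
  qed
  moreover have "iso_arr A ?I"
    unfolding iso_arr_def using I Ident_left[OF I] homsD[OF I] by auto
  ultimately show "descent A X n \<F>"
    unfolding descent_def using lim I by blast
next
  fix T assume "descent A X n \<F>" and T: "T \<in> Obj A"
  then obtain L p u where lim: "is_X_over A X n \<F> L p" and u: "u \<in> homs A (fobj X n) L"
    and pu: "\<And>\<sigma>. \<sigma> \<in> Obj (simplices_over n \<F>) \<Longrightarrow> p \<sigma> \<cdot> u = fmap X \<sigma>" and iso: "iso_arr A u"
    unfolding descent_def by blast
  obtain v where v: "v \<in> homs A L (fobj X n)" "v \<cdot> u = Ident A (fobj X n)" "u \<cdot> v = Ident A L"
    using iso homsD[OF u] unfolding iso_arr_def by auto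
  have p: "p \<sigma> \<in> homs A L (fobj X (Dom Delta \<sigma>))" if "\<sigma> \<in> Obj (simplices_over n \<F>)" for \<sigma>
    using lim that
    by (simp add: is_X_over_def is_limit_def is_cone_def op_cat_def comp_functor_def simplices_forget_def)
  interpret G: simplicial_abelian_group "hom_sgroup A X T" "hom_act A X"
    using T by (rule simplicial_hom)
  show "G.glues n \<F>"
    unfolding G.glues_def
  proof (intro allI impI)
    fix c assume c: "G.matching n \<F> c"
    define q where "q \<sigma> = c (fst \<sigma>) (snd (snd \<sigma>))" for \<sigma> :: delta_arr
    have qc: "q (delta_map k n \<sigma>) = c k \<sigma>" if "simplex_over n \<F> k \<sigma>" for k \<sigma>
      using G.matching_restrict[OF c that] by (simp add: q_def delta_map_def)
    have "G.matching n \<F> (\<lambda>k \<sigma>. q (delta_map k n \<sigma>))"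
      using qc c by (rule G.matching_cong)
    then have "is_cone A (op_cat (simplices_over n \<F>)) (comp_functor X simplices_forget) T q"
      using is_cone_iff_matching[OF T] by simp
    then have ex: "\<exists>!w. w \<in> homs A T L \<and> (\<forall>j \<in> Obj (op_cat (simplices_over n \<F>)). p j \<cdot> w = q j)"
      using lim by (simp add: is_X_over_def is_limit_def)
    have obj: "Obj (op_cat (simplices_over n \<F>)) = Obj (simplices_over n \<F>)" by (simp add: op_cat_def)
    have key: "(\<forall>j \<in> Obj (op_cat (simplices_over n \<F>)). p j \<cdot> (u \<cdot> x) = q j) \<longleftrightarrow>
        (\<forall>k \<sigma>. simplex_over n \<F> k \<sigma> \<longrightarrow> hom_act A X k n \<sigma> x = c k \<sigma>)"
      if x: "x \<in> homs A T (fobj X n)" for x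
    proof -
      have "p j \<cdot> (u \<cdot> x) = fmap X j \<cdot> x" if "j \<in> Obj (simplices_over n \<F>)" for j
        using Comp_assoc[OF p[OF that] u x] pu[OF that] by simp
      then have "(\<forall>j \<in> Obj (op_cat (simplices_over n \<F>)). p j \<cdot> (u \<cdot> x) = q j) \<longleftrightarrow>
          (\<forall>j \<in> Obj (op_cat (simplices_over n \<F>)). fmap X j \<cdot> x = q j)" unfolding obj by simp
      then show ?thesis using qc unfolding restrict_eq_iff by simp
    qed
    show "\<exists>!x. x \<in> carrier (hom_sgroup A X T n) \<and>
        (\<forall>k \<sigma>. simplex_over n \<F> k \<sigma> \<longrightarrow> hom_act A X k n \<sigma> x = c k \<sigma>)"
      unfolding carrier_hom_sgroup
    proof (rule ex_ex1I)
      obtain w where w: "w \<in> homs A T L" "\<forall>j \<in> Obj (op_cat (simplices_over n \<F>)). p j \<cdot> w = q j"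
        using ex by blast
      have vw: "v \<cdot> w \<in> homs A T (fobj X n)" using Comp_homs[OF v(1) w(1)] .
      have "u \<cdot> (v \<cdot> w) = w"
        using Comp_assoc[OF u v(1) w(1)] v(3) Ident_left[OF w(1)] by simp
      then show "\<exists>x. x \<in> homs A T (fobj X n) \<and>
          (\<forall>k \<sigma>. simplex_over n \<F> k \<sigma> \<longrightarrow> hom_act A X k n \<sigma> x = c k \<sigma>)"
        using key[OF vw] w(2) vw by (intro exI[of _ "v \<cdot> w"]) simp
    next
      fix x y
      assume "x \<in> homs A T (fobj X n) \<and> (\<forall>k \<sigma>. simplex_over n \<F> k \<sigma> \<longrightarrow> hom_act A X k n \<sigma> x = c k \<sigma>)"
        and "y \<in> homs A T (fobj X n) \<and> (\<forall>k \<sigma>. simplex_over n \<F> k \<sigma> \<longrightarrow> hom_act A X k n \<sigma> y = c k \<sigma>)"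
      then have x: "x \<in> homs A T (fobj X n)" and y: "y \<in> homs A T (fobj X n)"
        and "\<forall>j \<in> Obj (op_cat (simplices_over n \<F>)). p j \<cdot> (u \<cdot> x) = q j"
        and "\<forall>j \<in> Obj (op_cat (simplices_over n \<F>)). p j \<cdot> (u \<cdot> y) = q j"
        using key by auto
      then have "u \<cdot> x = u \<cdot> y" using ex Comp_homs[OF u x] Comp_homs[OF u y] by blast
      moreover have "v \<cdot> (u \<cdot> z) = z" if "z \<in> homs A T (fobj X n)" for z
        using Comp_assoc[OF v(1) u that] v(2) Ident_left[OF that] by simp
      ultimately show "x = y" using x y by metis
    qed
  qed
qed

text \<open>Kernels and intersections are limits too: the elements of \<open>Hom(T, X\<^sub>n)\<close> killed by \<open>d\<^sub>1, \<dots>, d\<^sub>n\<close> are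
  those that factor through the Moore subobject.\<close>

lemma zero_moore_iff_cycles_trivial:
  assumes n: "n \<ge> 1"
  shows "zero_object A (chain_obj (moore_complex A X) n) \<longleftrightarrow>
    (\<forall>T \<in> Obj A. hom_cycles A X T 0 n \<subseteq> {\<one>\<^bsub>hom_sgroup A X T n\<^esub>})"
proof -
  let ?Z = "chain_obj (moore_complex A X) n"
  let ?i = "moore_incl A X n"
  note incl = moore_incl_homs[OF abelian simplicial, of n]
  note intersection = is_intersection_moore_incl[OF abelian simplicial, of n]
  have Z: "?Z \<in> Obj A" "Dom A ?i = ?Z" using homsD[OF incl] by auto
  have cycles: "h \<in> hom_cycles A X T 0 n \<longleftrightarrow>
      h \<in> homs A T (fobj X n) \<and> (\<forall>j \<in> {1..n}. face X n j \<cdot> h = hom_zero A T (fobj X (n - 1)))"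
    if T: "T \<in> Obj A" for T h
  proof -
    interpret G: simplicial_abelian_group "hom_sgroup A X T" "hom_act A X"
      using T by (rule simplicial_hom)
    show ?thesis
      by (auto simp: G.cycles_def carrier_hom_sgroup one_hom_sgroup hom_act_def face_def
          coface_eq_delta_map)
  qed
  show ?thesis
  proof (intro iffI ballI subsetI)
    fix T h
    assume zero: "zero_object A ?Z" and T: "T \<in> Obj A" and h: "h \<in> hom_cycles A X T 0 n"
    have hh: "h \<in> homs A T (fobj X n)" using h cycles[OF T] by simp
    have "factors_through A h (kernel_arr A (face X n j))" if j: "j \<in> {1..n}" for j
      using h j cycles[OF T] factors_through_kernel[OF face_homs[OF abelian simplicial n] hh] by simp
    then have "factors_through A h ?i"
      using intersection hh T by (simp add: is_intersection_def)
    then obtain w where w: "w \<in> homs A T ?Z" "?i \<cdot> w = h"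
      using homsD[OF hh] Z by (auto simp: factors_through_def)
    have "w = hom_zero A T ?Z"
      using zero T w(1) hom_zero_homs[OF T Z(1)] unfolding zero_object_def by blast
    then show "h \<in> {\<one>\<^bsub>hom_sgroup A X T n\<^esub>}"
      using w(2) Comp_zero[OF incl T] by (simp add: one_hom_sgroup)
  next
    assume trivial: "\<forall>T \<in> Obj A. hom_cycles A X T 0 n \<subseteq> {\<one>\<^bsub>hom_sgroup A X T n\<^esub>}"
    have "?i \<in> hom_cycles A X ?Z 0 n"
      using cycles[OF Z(1)] incl face_moore_incl[OF abelian simplicial] by simp
    then have "?i = hom_zero A ?Z (fobj X n)" using trivial Z(1) by (auto simp: one_hom_sgroup)
    have I: "Ident A ?Z \<in> homs A ?Z ?Z" using Z(1) by (rule Ident_homs)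
    have "?i \<cdot> Ident A ?Z = ?i \<cdot> hom_zero A ?Z ?Z"
      using Ident_right[OF incl] Comp_zero[OF incl Z(1)] \<open>?i = hom_zero A ?Z (fobj X n)\<close> by simp
    then have id: "Ident A ?Z = hom_zero A ?Z ?Z"
      using moore_incl_cancel[OF abelian simplicial I hom_zero_homs[OF Z(1) Z(1)]] by simp
    have "f = hom_zero A a ?Z" if "f \<in> homs A a ?Z" for a f
      using Ident_left[OF that] zero_Comp[OF that Z(1)] id by simp
    moreover have "f = hom_zero A ?Z a" if "f \<in> homs A ?Z a" for a f
      using Ident_right[OF that] Comp_zero[OF that Z(1)] id by simp
    ultimately show "zero_object A ?Z"
      unfolding zero_object_def using Z(1) hom_zero_homs by blast
  qed
qed

lemma truncated_iff_cycles_trivial: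
  "truncated A m (moore_complex A X) \<longleftrightarrow>
    (\<forall>T \<in> Obj A. \<forall>k > m. hom_cycles A X T 0 k \<subseteq> {\<one>\<^bsub>hom_sgroup A X T k\<^esub>})"
proof -
  have "k \<ge> 1" if "k > m" for k using that by simp
  then show ?thesis unfolding truncated_def using zero_moore_iff_cycles_trivial by blast
qed

lemma outer_kan_iff_truncated: "outer_kan A m X \<longleftrightarrow> truncated A m (moore_complex A X)"
  unfolding truncated_iff_cycles_trivial
proof (intro iffI ballI allI impI)
  fix T k assume kan: "outer_kan A m X" and T: "T \<in> Obj A" and k: "k > m"
  interpret G: simplicial_abelian_group "hom_sgroup A X T" "hom_act A X"
    using T by (rule simplicial_hom)
  have "G.glues k (horn k 0)"
    using kan k T by (simp add: outer_kan_def descent_iff_glues)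
  then show "G.cycles 0 k \<subseteq> {\<one>\<^bsub>hom_sgroup A X T k\<^esub>}"
    using k by (intro G.glues_horn_imp_cycles_trivial) simp_all
next
  assume trivial: "\<forall>T \<in> Obj A. \<forall>k > m. hom_cycles A X T 0 k \<subseteq> {\<one>\<^bsub>hom_sgroup A X T k\<^esub>}"
  show "outer_kan A m X"
    unfolding outer_kan_def descent_iff_glues
  proof (intro allI impI conjI ballI)
    fix n T assume n: "m < n" and T: "T \<in> Obj A"
    interpret G: simplicial_abelian_group "hom_sgroup A X T" "hom_act A X"
      using T by (rule simplicial_hom)
    have "G.cycles 0 k \<subseteq> {\<one>\<^bsub>hom_sgroup A X T k\<^esub>}" if "k > m" for k using trivial T that by blast
    from G.glues_horns[OF this n] show "G.glues n (horn n 0)" "G.glues n (horn n n)" by blast+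
  qed
qed

text \<open>For the direction from Segal to truncated in degree \<open>k > m\<close>, the lower cover of \<open>[2k - 1]\<close> suffices,
  which is in the Segal range as \<open>2k - 1 \<ge> 2m\<close>.\<close>

lemma segal_iff_truncated: "segal A (2 * m) X \<longleftrightarrow> truncated A m (moore_complex A X)"
  unfolding truncated_iff_cycles_trivial
proof (intro iffI ballI allI impI)
  fix T k assume segal: "segal A (2 * m) X" and T: "T \<in> Obj A" and k: "k > m"
  interpret G: simplicial_abelian_group "hom_sgroup A X T" "hom_act A X"
    using T by (rule simplicial_hom)
  have "2 * m \<le> 2 * k - 1" using k by simp
  then have "G.glues (2 * k - 1) (lower_segal_cover (2 * m) (2 * k - 1))"
    using segal T by (simp add: segal_def descent_iff_glues)
  moreover have "k \<ge> 1" using k by simp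
  ultimately show "G.cycles 0 k \<subseteq> {\<one>\<^bsub>hom_sgroup A X T k\<^esub>}"
    by (metis G.glues_avoiding_odd_imp_cycles_trivial lower_misses_odd)
next
  assume trivial: "\<forall>T \<in> Obj A. \<forall>k > m. hom_cycles A X T 0 k \<subseteq> {\<one>\<^bsub>hom_sgroup A X T k\<^esub>}"
  show "segal A (2 * m) X"
    unfolding segal_def descent_iff_glues
  proof (intro allI impI conjI ballI)
    fix n T assume n: "2 * m \<le> n" and T: "T \<in> Obj A"
    interpret G: simplicial_abelian_group "hom_sgroup A X T" "hom_act A X"
      using T by (rule simplicial_hom)
    have "G.cycles 0 k \<subseteq> {\<one>\<^bsub>hom_sgroup A X T k\<^esub>}" if "k > m" for k using trivial T that by blast
    from G.glues_segal_covers[OF this n]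
    show "G.glues n (lower_segal_cover (2 * m) n)" "G.glues n (upper_segal_cover (2 * m) n)" by blast+
  qed
qed

end

theorem theorem4p9:
  fixes A :: "('o, 'm) ab_cat" and X :: "('o, 'm) sobj" and m :: nat
  assumes "abelian_category A"
    and "simplicial_object A X"
    and "m \<ge> 1"
  shows "(segal A (2 * m) X \<longleftrightarrow> outer_kan A m X) \<and>
         (outer_kan A m X \<longleftrightarrow> truncated A m (moore_complex A X))"
  using segal_iff_truncated[OF assms(1,2), of m] outer_kan_iff_truncated[OF assms(1,2), of m] by blast

end
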